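(* Let $n\ge 2$, $N=\mathbb{R}^n$, and let $F_t$ be a time-only dependent Finsler metric on $N$ satisfying the standing bounds given in the context. Let the initial region $A\subset N$ be either a compact embedded hypersurface of $N$ or a single point. If $A$ is convex (or a single point), then the wavemap $f$ from $A$ has no cut points, i.e. every spatial trajectory $t\mapsto f(t,z_0)$ of the wavemap is strictly time-minimizing from $A$ at every time $\tau>0$.
   Context: Setting: $N=\mathbb{R}^n$ ($n\ge2$), spacetime $M=\mathbb{R}\times N$ with points $(t,x)$ and tangent vectors $\hat v=(v^0,v)$. All curves are regular and piecewise smooth unless otherwise stated. A time-dependent Finsler metric $F_t$ on $N$ is a function $F_t(v)\equiv F(t,x,v)\in[0,\infty)$ ($t\in\mathbb{R}$, $x\in N$, $v\in T_xN$), varying smoothly with $t$, continuous everywhere with $F_t(0)=0$, smooth away from the zero vector, positive for $v\ne0$, positively homogeneous of degree 1 in $v$ (not necessarily symmetric), and whose indicatrix $\Sigma_{(t,x)}=\{v\in T_xN:F_t(v)=1\}$ is strongly convex, i.e. the fundamental tensor $g^{F_t}_v(u,w)=\frac12\frac{\partial^2}{\partial\delta\,\partial\eta}F_t(v+\delta u+\eta w)^2|_{\delta=\eta=0}$ is positive definite for every $v\neq 0$. It is time-only dependent if $F(t,x,v)=F(t,v)$ does not depend on $x$. Standing assumption: $F_t$ is bounded above by some time-independent Finsler metric and bounded below by some time-independent complete Finsler metric (complete: every geodesic extends to all of $\mathbb{R}$). A vector $v\in T_xN\setminus\{0\}$ is $F_t$-orthogonal to a submanifold $S\ni x$ at time $t$,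 written $v\perp_{F_t}S$, if $g^{F_t}_v(v,u)=0$ for all $u\in T_xS$; if $S$ is a single point, every vector is orthogonal to it. The associated Lorentz-Finsler metric is $H(\hat v)=(v^0)^2-F_t(v)^2$. A curve $\hat\gamma(s)=(t(s),\gamma(s))$ is (future-directed) causal if $t'>0$ and $H(\hat\gamma')\ge0$ along it, and lightlike if $t'>0$ and $H(\hat\gamma')=0$. Geodesics of $H$ between two points of $M$ are the critical points of $\int_a^bH(\hat\gamma'(s))\,ds$ among curves with the same fixed endpoints; pregeodesics are curves that become geodesics after an orientation-preserving reparametrization. Wavemap from $A$: the map $f:[0,\infty)\times A\to N$ such that, for each $z_0\in A$, $t\mapsto(t,f(t,z_0))$ is the unique $t$-parametrized lightlike pregeodesic of $H$ with $f(0,z_0)=z_0$ and $\partial_tf(0,z_0)\perp_{F_0}A$ pointing outward from $A$. If $A$ is a single point, the parameter $z$ instead parametrizes the directions of $T_AN$ (one trajectory for each initial velocity in $\Sigma_{(0,A)}$). The curves $t\mapsto f(t,z)$ are the spatial trajectories. A spatial trajectory $t\mapsto f(t,z_0)$ is time-minimizing (resp. strictly time-minimizing) from $A$ at time $\tau>0$ if for every $t_0\in(0,\tau]$, any $t$-parametrized causal curve $(t,\varphi(t))$ with $\varphi(0)\in A$ and $\varphi(t_1)=f(t_0,z_0)$ (in the strict case: any such curve other than the trajectory $t\mapsto (t,f(t,z_0))$, $t\in[0,t_0]$, itself) satisfies $t_0\le t_1$ (resp. $t_0<t_1$). The wavefront at time $\tau>0$ is $\mathcal{W}_\tau=\{f(\tau,z):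 t\mapsto f(t,z)\text{ is time-minimizing at }\tau\}$, and $\mathcal{W}_0=A$. The cut function is $c(z)=\sup\{t>0:f(t,z)\in\mathcal{W}_t\}\in(0,\infty]$; if $c(z)<\infty$, then $f(c(z),z)$ is the cut point of the trajectory. A compact hypersurface $A$ is called convex if the region it encloses is a convex subset of $\mathbb{R}^n$. *)

theory Defs
  imports "HOL-Analysis.Analysis"
begin

section \<open>Smooth maps and submanifolds\<close>

text \<open>Continuous differentiability of order \<open>k\<close> on an open set (of a finite-dimensional space),
  through iterated directional derivatives.\<close>

primrec Ck_on :: "nat \<Rightarrow> ('a::euclidean_space \<Rightarrow> 'b::real_normed_vector) \<Rightarrow> 'a set \<Rightarrow> bool" where
  "Ck_on 0 f U \<longleftrightarrow> continuous_on U f"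
| "Ck_on (Suc k) f U \<longleftrightarrow>
     (\<forall>x\<in>U. f differentiable (at x)) \<and>
     (\<forall>v. Ck_on k (\<lambda>x. frechet_derivative f (at x) v) U)"

text \<open>On an arbitrary set, smooth means being the restriction of a smooth map defined on an open
  neighbourhood; in particular derivatives at boundary points are one-sided.\<close>

definition smooth_on :: "('a::euclidean_space \<Rightarrow> 'b::real_normed_vector) \<Rightarrow> 'a set \<Rightarrow> bool" where
  "smooth_on f S \<longleftrightarrow>
     (\<exists>U g. open U \<and> S \<subseteq> U \<and> (\<forall>k. Ck_on k g U) \<and> (\<forall>x\<in>S. g x = f x))"

definition embedded_submanifold :: "nat \<Rightarrow> 'a::euclidean_space set \<Rightarrow> bool" where
  "embedded_submanifold k S \<longleftrightarrow>
     (\<forall>p\<in>S. \<exists>(U::'a set) (V::'a set) \<phi> \<psi> L. open U \<and> p \<in> U \<and> open V \<and> homeomorphism U V \<phi> \<psi> \<and>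
        smooth_on \<phi> U \<and> smooth_on \<psi> V \<and>
        subspace L \<and> dim L = k \<and> \<phi> ` (S \<inter> U) = L \<inter> V)"

definition compact_hypersurface :: "'a::euclidean_space set \<Rightarrow> bool" where
  "compact_hypersurface A \<longleftrightarrow> compact A \<and> embedded_submanifold (DIM('a) - 1) A"

text \<open>The region enclosed by \<open>A\<close> is taken to be closed, i.e. to contain its boundary \<open>A\<close>.\<close>

definition convex_hypersurface :: "'a::euclidean_space set \<Rightarrow> bool" where
  "convex_hypersurface A \<longleftrightarrow> convex (A \<union> inside A)"

text \<open>Velocities of smooth curves running in \<open>S\<close>; this is \<open>{0}\<close> when \<open>S\<close> is a single point.\<close>

definition tangent_space :: "'a::euclidean_space set \<Rightarrow> 'a \<Rightarrow> 'a set" where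
  "tangent_space S x =
     {u. \<exists>\<epsilon>>0. \<exists>c. smooth_on c {-\<epsilon><..<\<epsilon>} \<and> c ` {-\<epsilon><..<\<epsilon>} \<subseteq> S \<and> c 0 = x \<and>
           (c has_vector_derivative u) (at 0)}"


section \<open>Piecewise smooth curves\<close>

definition partition_of :: "real \<Rightarrow> real \<Rightarrow> nat \<Rightarrow> (nat \<Rightarrow> real) \<Rightarrow> bool" where
  "partition_of a b m p \<longleftrightarrow> p 0 = a \<and> p m = b \<and> (\<forall>i<m. p i < p (Suc i))"

text \<open>The pieces are closed and share their end points, so continuity is implied.\<close>

definition piecewise_smooth_on :: "real set \<Rightarrow> (real \<Rightarrow> 'm::euclidean_space) \<Rightarrow> bool" where
  "piecewise_smooth_on I c \<longleftrightarrow>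
     (\<forall>a b. a < b \<and> {a..b} \<subseteq> I \<longrightarrow>
        (\<exists>m p. partition_of a b m p \<and> (\<forall>i<m. smooth_on c {p i..p (Suc i)})))"

text \<open>The velocities at \<open>s\<close> of a curve defined on the interval \<open>I\<close>: the right and the left one
  (as far as \<open>I\<close> extends to that side of \<open>s\<close>), which differ at a break.\<close>

definition velocities :: "real set \<Rightarrow> (real \<Rightarrow> 'm::real_normed_vector) \<Rightarrow> real \<Rightarrow> 'm set" where
  "velocities I c s =
     {w. ((\<exists>r\<in>I. s < r) \<and> (c has_vector_derivative w) (at_right s)) \<or>
         ((\<exists>r\<in>I. r < s) \<and> (c has_vector_derivative w) (at_left s))}"

definition regular_curve_on :: "real set \<Rightarrow> (real \<Rightarrow> 'm::euclidean_space) \<Rightarrow> bool" where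
  "regular_curve_on I c \<longleftrightarrow> piecewise_smooth_on I c \<and> (\<forall>s\<in>I. 0 \<notin> velocities I c s)"


section \<open>Geodesics as critical points\<close>

text \<open>Below, \<open>L x w\<close> is a function of a point \<open>x\<close> and a tangent vector \<open>w\<close> at \<open>x\<close>.\<close>

definition action :: "('m \<Rightarrow> 'm \<Rightarrow> real) \<Rightarrow> real \<Rightarrow> real \<Rightarrow> (real \<Rightarrow> 'm::euclidean_space) \<Rightarrow> real" where
  "action L a b c = integral {a..b} (\<lambda>s. L (c s) (vector_derivative c (at s)))"

text \<open>\<open>\<Gamma> \<omega> s\<close>: variation parameter \<open>\<omega>\<close>, curve parameter \<open>s\<close>.  When \<open>c\<close> is regular, so are the
  curves \<open>\<Gamma> \<omega>\<close> for small \<open>\<omega>\<close>, by compactness of \<open>{a..b}\<close>.\<close>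

definition fixed_endpoint_variation ::
  "real \<Rightarrow> real \<Rightarrow> (real \<Rightarrow> 'm::euclidean_space) \<Rightarrow> (real \<Rightarrow> real \<Rightarrow> 'm) \<Rightarrow> bool" where
  "fixed_endpoint_variation a b c \<Gamma> \<longleftrightarrow>
     (\<exists>\<epsilon>>0. \<exists>m p. partition_of a b m p \<and>
        (\<forall>i<m. smooth_on (\<lambda>(\<omega>, s). \<Gamma> \<omega> s) ({-\<epsilon><..<\<epsilon>} \<times> {p i..p (Suc i)})) \<and>
        (\<forall>s\<in>{a..b}. \<Gamma> 0 s = c s) \<and>
        (\<forall>\<omega>\<in>{-\<epsilon><..<\<epsilon>}. \<Gamma> \<omega> a = c a \<and> \<Gamma> \<omega> b = c b))"

definition critical_curve ::
  "('m \<Rightarrow> 'm \<Rightarrow> real) \<Rightarrow> real \<Rightarrow> real \<Rightarrow> (real \<Rightarrow> 'm::euclidean_space) \<Rightarrow> bool" where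
  "critical_curve L a b c \<longleftrightarrow>
     (\<forall>\<Gamma>. fixed_endpoint_variation a b c \<Gamma> \<longrightarrow>
        ((\<lambda>\<omega>. action L a b (\<Gamma> \<omega>)) has_real_derivative 0) (at 0))"

definition geodesic_on ::
  "('m \<Rightarrow> 'm \<Rightarrow> real) \<Rightarrow> real set \<Rightarrow> (real \<Rightarrow> 'm::euclidean_space) \<Rightarrow> bool" where
  "geodesic_on L I c \<longleftrightarrow>
     regular_curve_on I c \<and> (\<forall>a b. a < b \<and> {a..b} \<subseteq> I \<longrightarrow> critical_curve L a b c)"

definition pregeodesic_on ::
  "('m \<Rightarrow> 'm \<Rightarrow> real) \<Rightarrow> real set \<Rightarrow> (real \<Rightarrow> 'm::euclidean_space) \<Rightarrow> bool" where
  "pregeodesic_on L I c \<longleftrightarrow>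
     (\<exists>J \<theta>. is_interval J \<and> \<theta> ` J = I \<and> piecewise_smooth_on J \<theta> \<and>
        (\<forall>s\<in>J. \<forall>w\<in>velocities J \<theta> s. 0 < w) \<and> geodesic_on L J (c \<circ> \<theta>))"


section \<open>Time-dependent Finsler metrics\<close>

definition fundamental_tensor ::
  "('a::euclidean_space \<Rightarrow> real) \<Rightarrow> 'a \<Rightarrow> 'a \<Rightarrow> 'a \<Rightarrow> real" where
  "fundamental_tensor F v u w =
     1/2 * deriv (\<lambda>\<delta>. deriv (\<lambda>\<eta>. (F (v + \<delta> *\<^sub>R u + \<eta> *\<^sub>R w))\<^sup>2) 0) 0"

definition time_dep_finsler :: "(real \<Rightarrow> 'a::euclidean_space \<Rightarrow> 'a \<Rightarrow> real) \<Rightarrow> bool" where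
  "time_dep_finsler F \<longleftrightarrow>
     continuous_on UNIV (\<lambda>(t, x, v). F t x v) \<and>
     smooth_on (\<lambda>(t, x, v). F t x v) {(t, x, v). v \<noteq> 0} \<and>
     (\<forall>t x. F t x 0 = 0) \<and>
     (\<forall>t x v. v \<noteq> 0 \<longrightarrow> 0 < F t x v) \<and>
     (\<forall>t x v k. 0 < k \<longrightarrow> F t x (k *\<^sub>R v) = k * F t x v) \<and>
     (\<forall>t x v u. v \<noteq> 0 \<and> u \<noteq> 0 \<longrightarrow> 0 < fundamental_tensor (F t x) v u u)"

definition time_only_dependent :: "(real \<Rightarrow> 'a \<Rightarrow> 'a \<Rightarrow> real) \<Rightarrow> bool" where
  "time_only_dependent F \<longleftrightarrow> (\<forall>t x y v. F t x v = F t y v)"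

definition finsler :: "('a::euclidean_space \<Rightarrow> 'a \<Rightarrow> real) \<Rightarrow> bool" where
  "finsler G \<longleftrightarrow> time_dep_finsler (\<lambda>_. G)"

definition complete_finsler :: "('a::euclidean_space \<Rightarrow> 'a \<Rightarrow> real) \<Rightarrow> bool" where
  "complete_finsler G \<longleftrightarrow> finsler G \<and>
     (\<forall>I c. is_interval I \<and> interior I \<noteq> {} \<and> geodesic_on (\<lambda>x w. (G x w)\<^sup>2) I c \<longrightarrow>
        (\<exists>c'. geodesic_on (\<lambda>x w. (G x w)\<^sup>2) UNIV c' \<and> (\<forall>s\<in>I. c' s = c s)))"

definition finsler_bounds :: "(real \<Rightarrow> 'a::euclidean_space \<Rightarrow> 'a \<Rightarrow> real) \<Rightarrow> bool" where
  "finsler_bounds F \<longleftrightarrow>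
     (\<exists>G. finsler G \<and> (\<forall>t x v. F t x v \<le> G x v)) \<and>
     (\<exists>G. complete_finsler G \<and> (\<forall>t x v. G x v \<le> F t x v))"

definition indicatrix :: "(real \<Rightarrow> 'a \<Rightarrow> 'a \<Rightarrow> real) \<Rightarrow> real \<Rightarrow> 'a \<Rightarrow> 'a set" where
  "indicatrix F t x = {v. F t x v = 1}"

definition finsler_orthogonal ::
  "(real \<Rightarrow> 'a::euclidean_space \<Rightarrow> 'a \<Rightarrow> real) \<Rightarrow> real \<Rightarrow> 'a \<Rightarrow> 'a \<Rightarrow> 'a set \<Rightarrow> bool" where
  "finsler_orthogonal F t x v S \<longleftrightarrow>
     v \<noteq> 0 \<and> (\<forall>u\<in>tangent_space S x. fundamental_tensor (F t x) v v u = 0)"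


section \<open>The Lorentz-Finsler metric on the spacetime\<close>

definition lorentz_finsler ::
  "(real \<Rightarrow> 'a \<Rightarrow> 'a \<Rightarrow> real) \<Rightarrow> real \<times> 'a \<Rightarrow> real \<times> 'a \<Rightarrow> real" where
  "lorentz_finsler F = (\<lambda>(t, x) (v0, v). v0\<^sup>2 - (F t x v)\<^sup>2)"

definition causal_on ::
  "(real \<Rightarrow> 'a \<Rightarrow> 'a \<Rightarrow> real) \<Rightarrow> real set \<Rightarrow> (real \<Rightarrow> real \<times> 'a::euclidean_space) \<Rightarrow> bool" where
  "causal_on F I c \<longleftrightarrow> regular_curve_on I c \<and>
     (\<forall>s\<in>I. \<forall>w\<in>velocities I c s. 0 < fst w \<and> 0 \<le> lorentz_finsler F (c s) w)"

definition lightlike_on ::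
  "(real \<Rightarrow> 'a \<Rightarrow> 'a \<Rightarrow> real) \<Rightarrow> real set \<Rightarrow> (real \<Rightarrow> real \<times> 'a::euclidean_space) \<Rightarrow> bool" where
  "lightlike_on F I c \<longleftrightarrow> regular_curve_on I c \<and>
     (\<forall>s\<in>I. \<forall>w\<in>velocities I c s. 0 < fst w \<and> lorentz_finsler F (c s) w = 0)"


section \<open>Wavemap, wavefront and cut function\<close>

definition points_outward :: "'a::euclidean_space set \<Rightarrow> 'a \<Rightarrow> 'a \<Rightarrow> bool" where
  "points_outward A x v \<longleftrightarrow> (\<exists>\<epsilon>>0. \<forall>s\<in>{0<..<\<epsilon>}. x + s *\<^sub>R v \<in> outside A)"

text \<open>The wavemap from \<open>A\<close> is parametrized by the points of \<open>A\<close> or, if \<open>A\<close> is a single point, by the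
  initial velocities of its trajectories.\<close>

definition wave_params :: "(real \<Rightarrow> 'a \<Rightarrow> 'a \<Rightarrow> real) \<Rightarrow> 'a set \<Rightarrow> 'a set" where
  "wave_params F A = (if is_singleton A then indicatrix F 0 (the_elem A) else A)"

definition wavemap ::
  "(real \<Rightarrow> 'a::euclidean_space \<Rightarrow> 'a \<Rightarrow> real) \<Rightarrow> 'a set \<Rightarrow> (real \<Rightarrow> 'a \<Rightarrow> 'a) \<Rightarrow> bool" where
  "wavemap F A f \<longleftrightarrow>
     (\<forall>z\<in>wave_params F A.
        lightlike_on F {0..} (\<lambda>t. (t, f t z)) \<and>
        pregeodesic_on (lorentz_finsler F) {0..} (\<lambda>t. (t, f t z)) \<and>
        (let v = vector_derivative (\<lambda>t. f t z) (at 0 within {0..}) in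
           if is_singleton A then f 0 z = the_elem A \<and> v = z
           else f 0 z = z \<and> finsler_orthogonal F 0 z v A \<and> points_outward A z v))"

text \<open>\<open>\<phi>\<close> is the spatial part of a \<open>t\<close>-parametrized causal curve from \<open>A\<close> to \<open>q\<close>, which it reaches
  at time \<open>t\<^sub>1\<close>.\<close>

definition causal_arrival ::
  "(real \<Rightarrow> 'a::euclidean_space \<Rightarrow> 'a \<Rightarrow> real) \<Rightarrow> 'a set \<Rightarrow> 'a \<Rightarrow> real \<Rightarrow> (real \<Rightarrow> 'a) \<Rightarrow> bool" where
  "causal_arrival F A q t\<^sub>1 \<phi> \<longleftrightarrow>
     0 < t\<^sub>1 \<and> causal_on F {0..t\<^sub>1} (\<lambda>t. (t, \<phi> t)) \<and> \<phi> 0 \<in> A \<and> \<phi> t\<^sub>1 = q"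

definition time_minimizing ::
  "(real \<Rightarrow> 'a::euclidean_space \<Rightarrow> 'a \<Rightarrow> real) \<Rightarrow> 'a set \<Rightarrow> (real \<Rightarrow> 'a \<Rightarrow> 'a) \<Rightarrow> 'a \<Rightarrow> real \<Rightarrow> bool" where
  "time_minimizing F A f z \<tau> \<longleftrightarrow>
     (\<forall>t\<^sub>0\<in>{0<..\<tau>}. \<forall>t\<^sub>1 \<phi>. causal_arrival F A (f t\<^sub>0 z) t\<^sub>1 \<phi> \<longrightarrow> t\<^sub>0 \<le> t\<^sub>1)"

definition strictly_time_minimizing ::
  "(real \<Rightarrow> 'a::euclidean_space \<Rightarrow> 'a \<Rightarrow> real) \<Rightarrow> 'a set \<Rightarrow> (real \<Rightarrow> 'a \<Rightarrow> 'a) \<Rightarrow> 'a \<Rightarrow> real \<Rightarrow> bool" where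
  "strictly_time_minimizing F A f z \<tau> \<longleftrightarrow>
     (\<forall>t\<^sub>0\<in>{0<..\<tau>}. \<forall>t\<^sub>1 \<phi>. causal_arrival F A (f t\<^sub>0 z) t\<^sub>1 \<phi> \<and>
        \<not> (t\<^sub>1 = t\<^sub>0 \<and> (\<forall>t\<in>{0..t\<^sub>0}. \<phi> t = f t z)) \<longrightarrow> t\<^sub>0 < t\<^sub>1)"

definition wavefront ::
  "(real \<Rightarrow> 'a::euclidean_space \<Rightarrow> 'a \<Rightarrow> real) \<Rightarrow> 'a set \<Rightarrow> (real \<Rightarrow> 'a \<Rightarrow> 'a) \<Rightarrow> real \<Rightarrow> 'a set" where
  "wavefront F A f \<tau> =
     (if \<tau> = 0 then A else {f \<tau> z | z. z \<in> wave_params F A \<and> time_minimizing F A f z \<tau>})"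

definition cut_function ::
  "(real \<Rightarrow> 'a::euclidean_space \<Rightarrow> 'a \<Rightarrow> real) \<Rightarrow> 'a set \<Rightarrow> (real \<Rightarrow> 'a \<Rightarrow> 'a) \<Rightarrow> 'a \<Rightarrow> ereal" where
  "cut_function F A f z = Sup {ereal t | t. 0 < t \<and> f t z \<in> wavefront F A f t}"

definition has_cut_point ::
  "(real \<Rightarrow> 'a::euclidean_space \<Rightarrow> 'a \<Rightarrow> real) \<Rightarrow> 'a set \<Rightarrow> (real \<Rightarrow> 'a \<Rightarrow> 'a) \<Rightarrow> 'a \<Rightarrow> bool" where
  "has_cut_point F A f z \<longleftrightarrow> cut_function F A f z < \<infinity>"

end

theory Submission
  imports Defs
begin

text \<open>Since \<open>F\<close> does not depend on the position, the spatial momentum covector of a geodesic of \<open>H\<close> is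
  conserved, so along a trajectory \<open>t \<mapsto> f t z\<close> the derivative of \<open>F\<^sub>t\<^sup>2\<close> at the velocity is always a
  positive multiple of one covector \<open>P\<close>.  By strong convexity of the indicatrices, \<open>P\<close> grows along
  the trajectory at least as fast as along any causal curve at the same time, with equality only
  for equal velocities.  The covector \<open>P\<close> vanishes on the tangent space of \<open>A\<close> at \<open>z\<close> and is positive on
  the outward initial velocity, so convexity makes it attain its maximum over \<open>A\<close> at \<open>z\<close>: a causal
  curve from \<open>A\<close> starts at a value of \<open>P\<close> that is no larger, and can never overtake.\<close>

section \<open>Closure properties of smooth maps\<close>

text \<open>Two obstacles shape the proof. Trajectories are given only as critical points of the
  action and may have corners, so there is no geodesic equation to start from and no two-sided
  velocity to rely on. Conservation is therefore extracted in integrated form: a spatial variation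
  with a tent profile leaves the time component alone and, as the energy ignores position, enters
  only by shifting the velocity by a constant on each side. The first variation then compares two
  averages, which settles smooth pieces and corners alike. Comparisons of curves use right
  derivatives only.

  The other obstacle is that orthogonality and outwardness are conditions at the single point
  \<open>z\<close>, while the comparison of starting values concerns all of \<open>A\<close>. The
  closed tangent cone of the enclosed region carries the information across: a point of
  \<open>A\<close> beyond the hyperplane would force this cone to contain the open half-space in
  which the initial velocity lies.

  The momentum is the velocity derivative of the square of F, hence takes the value 2 on a unit
  velocity at itself; the recurring bound 2 comes from there.\<close>

lemma Ck_on_cong:
  assumes "open U" "\<And>x. x \<in> U \<Longrightarrow> f x = g x" "Ck_on k f U"
  shows "Ck_on k g U"
  using assms(2,3)
proof (induction k arbitrary: f g)
  case 0
  then show ?case by (simp cong: continuous_on_cong)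
next
  case (Suc k)
  have eq: "(g has_derivative D) (at x) \<longleftrightarrow> (f has_derivative D) (at x)" if "x \<in> U" for x D
    using has_derivative_transform_within_open[of f D x UNIV U g]
      has_derivative_transform_within_open[of g D x UNIV U f] \<open>open U\<close> that Suc.prems(1) by auto
  have fr: "frechet_derivative g (at x) = frechet_derivative f (at x)" if "x \<in> U" for x
    using eq[OF that] by (simp add: frechet_derivative_def)
  have "Ck_on k (\<lambda>x. frechet_derivative g (at x) v) U" for v
    using Suc.IH[of "\<lambda>x. frechet_derivative f (at x) v"] Suc.prems(2) fr by simp
  then show ?case
    using Suc.prems(2) eq by (auto simp: differentiable_def)
qed

lemma Ck_on_subset: "Ck_on k f U \<Longrightarrow> V \<subseteq> U \<Longrightarrow> Ck_on k f V"
  by (induction k arbitrary: f) (auto intro: continuous_on_subset)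

lemma Ck_on_Suc_imp: "Ck_on (Suc k) f U \<Longrightarrow> Ck_on k f U"
proof (induction k arbitrary: f)
  case 0
  then have "f differentiable_on U"
    by (auto simp: differentiable_on_def intro: differentiable_at_withinI)
  then show ?case
    by (simp add: differentiable_imp_continuous_on)
next
  case (Suc k)
  from Suc.prems show ?case
    by (subst Ck_on.simps(2)) (metis Ck_on.simps(2) Suc.IH)
qed

lemma Ck_on_add:
  assumes "open U" "Ck_on k f U" "Ck_on k g U"
  shows "Ck_on k (\<lambda>x. f x + g x) U"
  using assms(2,3)
proof (induction k arbitrary: f g)
  case 0
  then show ?case by (auto intro: continuous_intros)
next
  case (Suc k)
  have d: "frechet_derivative f (at x) v + frechet_derivative g (at x) v
      = frechet_derivative (\<lambda>x. f x + g x) (at x) v" if "x \<in> U" for x v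
  proof -
    have "((\<lambda>x. f x + g x) has_derivative
        (\<lambda>v. frechet_derivative f (at x) v + frechet_derivative g (at x) v)) (at x)"
      using Suc.prems that by (intro has_derivative_add) (auto simp: frechet_derivative_works)
    then show ?thesis by (rule fun_cong[OF frechet_derivative_at])
  qed
  have "Ck_on k (\<lambda>x. frechet_derivative f (at x) v + frechet_derivative g (at x) v) U" for v
    using Suc.prems by (intro Suc.IH[of "\<lambda>x. frechet_derivative f (at x) v" for v]) auto
  then have "Ck_on k (\<lambda>x. frechet_derivative (\<lambda>x. f x + g x) (at x) v) U" for v
    by (rule Ck_on_cong[OF \<open>open U\<close>, rotated]) (rule d)
  then show ?case
    using Suc.prems by (auto intro: differentiable_add)
qed

lemma Ck_on_scaleR:
  fixes f :: "'a::euclidean_space \<Rightarrow> real" and g :: "'a \<Rightarrow> 'b::euclidean_space"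
  assumes "open U" "Ck_on k f U" "Ck_on k g U"
  shows "Ck_on k (\<lambda>x. f x *\<^sub>R g x) U"
  using assms(2,3)
proof (induction k arbitrary: f g)
  case 0
  then show ?case unfolding Ck_on.simps(1) by (rule continuous_on_scaleR)
next
  case (Suc k)
  let ?f = "\<lambda>v x. frechet_derivative f (at x) v" and ?g = "\<lambda>v x. frechet_derivative g (at x) v"
  let ?D = "\<lambda>v x. f x *\<^sub>R ?g v x + ?f v x *\<^sub>R g x"
  have d: "((\<lambda>x. f x *\<^sub>R g x) has_derivative (\<lambda>v. ?D v x)) (at x)" if "x \<in> U" for x
    using Suc.prems that unfolding Ck_on.simps(2) frechet_derivative_works
    by (intro has_derivative_scaleR) blast+
  have "Ck_on k (\<lambda>x. f x *\<^sub>R ?g v x) U" for v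
    by (rule Suc.IH[OF Ck_on_Suc_imp[OF Suc.prems(1)]]) (use Suc.prems(2) in simp)
  moreover have "Ck_on k (\<lambda>x. ?f v x *\<^sub>R g x) U" for v
    by (rule Suc.IH[OF _ Ck_on_Suc_imp[OF Suc.prems(2)]]) (use Suc.prems(1) in simp)
  ultimately have "Ck_on k (?D v) U" for v
    by (rule Ck_on_add[OF \<open>open U\<close>])
  then have "Ck_on k (\<lambda>x. frechet_derivative (\<lambda>x. f x *\<^sub>R g x) (at x) v) U" for v
    by (rule Ck_on_cong[OF \<open>open U\<close>, rotated]) (rule fun_cong[OF frechet_derivative_at[OF d]])
  moreover have "\<forall>x\<in>U. (\<lambda>x. f x *\<^sub>R g x) differentiable (at x)"
    using d unfolding differentiable_def by blast
  ultimately show ?case unfolding Ck_on.simps(2) by (intro conjI allI)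
qed

text \<open>Affine inner maps cover the needs below: freezing the position in \<open>F\<close>,
  projecting to the curve parameter, restricting an inverse chart to a line. Their derivative
  \<open>l\<close> is constant, so the derivative in direction \<open>v\<close> is again a composite
  of the same shape and the induction closes without a product rule.\<close>

lemma Ck_on_compose_affine:
  fixes l :: "'a::euclidean_space \<Rightarrow> 'b::euclidean_space"
  assumes "open U" "bounded_linear l" "Ck_on k f U"
  shows "Ck_on k (\<lambda>x. f (c + l x)) ((\<lambda>x. c + l x) -` U)"
  using assms(3)
proof (induction k arbitrary: f)
  case 0
  have "continuous_on ((\<lambda>x. c + l x) -` U) (\<lambda>x. c + l x)"
    by (intro continuous_on_add continuous_on_const linear_continuous_on[OF \<open>bounded_linear l\<close>])
  moreover have "continuous_on U f" using 0 by simp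
  ultimately have "continuous_on ((\<lambda>x. c + l x) -` U) (\<lambda>x. f (c + l x))"
    by (intro continuous_on_compose2[of U f _ "\<lambda>x. c + l x"]) auto
  then show ?case by simp
next
  case (Suc k)
  let ?V = "(\<lambda>x. c + l x) -` U"
  have "open ?V"
    by (intro open_vimage \<open>open U\<close> continuous_on_add continuous_on_const
        linear_continuous_on[OF \<open>bounded_linear l\<close>])
  have f: "\<forall>x\<in>U. f differentiable (at x)" "Ck_on k (\<lambda>x. frechet_derivative f (at x) v) U" for v
    using Suc.prems by simp_all
  have D: "((\<lambda>x. f (c + l x)) has_derivative (\<lambda>v. frechet_derivative f (at (c + l x)) (l v))) (at x)"
    if "x \<in> ?V" for x
  proof -
    have "((\<lambda>x. c + l x) has_derivative (\<lambda>v. 0 + l v)) (at x)"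
      by (intro has_derivative_add has_derivative_const
          bounded_linear_imp_has_derivative[OF \<open>bounded_linear l\<close>])
    then have 1: "((\<lambda>x. c + l x) has_derivative l) (at x)"
      by simp
    have 2: "(f has_derivative frechet_derivative f (at (c + l x))) (at (c + l x))"
      using f(1) that by (simp add: frechet_derivative_works)
    show ?thesis using has_derivative_compose[OF 1 2] .
  qed
  have eq: "frechet_derivative f (at (c + l x)) (l v) = frechet_derivative (\<lambda>x. f (c + l x)) (at x) v"
    if "x \<in> ?V" for x v
    by (rule fun_cong[OF frechet_derivative_at[OF D[OF that]]])
  have "Ck_on k (\<lambda>x. frechet_derivative f (at (c + l x)) (l v)) ?V" for v
    by (rule Suc.IH[OF f(2)])
  then have "Ck_on k (\<lambda>x. frechet_derivative (\<lambda>x. f (c + l x)) (at x) v) ?V" for v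
    by (rule Ck_on_cong[OF \<open>open ?V\<close>, rotated]) (rule eq)
  moreover have "\<forall>x\<in>?V. (\<lambda>x. f (c + l x)) differentiable (at x)"
    using D unfolding differentiable_def by blast
  ultimately show ?case by simp
qed

lemma Ck_on_const: "Ck_on k (\<lambda>_. c) U"
proof (induction k arbitrary: c)
  case (Suc k)
  have "frechet_derivative (\<lambda>_. c) (at x) v = 0" for x v
    by (rule fun_cong[OF frechet_derivative_at[OF has_derivative_const, symmetric]])
  then show ?case using Suc by simp
qed simp

lemma Ck_on_bounded_linear:
  assumes "bounded_linear l"
  shows "Ck_on k l U"
proof (cases k)
  case 0
  then show ?thesis by (simp add: linear_continuous_on assms)
next
  case (Suc m)
  have D: "(l has_derivative l) (at x)" for x
    by (rule bounded_linear_imp_has_derivative[OF assms])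
  have "frechet_derivative l (at x) v = l v" for x v
    by (rule fun_cong[OF frechet_derivative_at[OF D, symmetric]])
  moreover have "l differentiable (at x)" for x
    using D[of x] unfolding differentiable_def by blast
  ultimately show ?thesis using Suc by (simp add: Ck_on_const)
qed

text \<open>This is the perturbation term of the later variations: the first coordinate is the
  variation parameter, the second the curve parameter.\<close>

lemma Ck_on_bilinear:
  fixes w :: "'a::euclidean_space"
  shows "Ck_on k (\<lambda>x::real \<times> real. (fst x * (\<alpha> + \<beta> * snd x)) *\<^sub>R w) UNIV"
proof -
  have "Ck_on k (\<lambda>x::real \<times> real. \<beta> *\<^sub>R snd x) UNIV"
    by (rule Ck_on_bounded_linear[OF bounded_linear_scaleR_right[THEN bounded_linear_compose[OF _ bounded_linear_snd]]])
  from Ck_on_add[OF open_UNIV Ck_on_const[of k \<alpha> UNIV] this]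
  have "Ck_on k (\<lambda>x::real \<times> real. \<alpha> + \<beta> * snd x) UNIV"
    by simp
  from Ck_on_scaleR[OF open_UNIV Ck_on_scaleR[OF open_UNIV Ck_on_bounded_linear[OF bounded_linear_fst] this]
      Ck_on_const[of k w UNIV]]
  show ?thesis by simp
qed

lemma smooth_on_openD:
  assumes "smooth_on f S" "open S"
  shows "Ck_on k f S"
proof -
  obtain U g where "open U" "S \<subseteq> U" "Ck_on k g U" "\<forall>x\<in>S. g x = f x"
    using assms(1) unfolding smooth_on_def by blast
  then show ?thesis
    using Ck_on_cong[OF \<open>open S\<close> _ Ck_on_subset[of k g U S], of f] by simp
qed

text \<open>Order two, because the momentum is a first derivative of the energy and must itself be
  differentiated along lines.\<close>

lemma Ck_on_2_derivative:
  assumes "Ck_on 2 f U" "x \<in> U"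
  shows "(f has_derivative frechet_derivative f (at x)) (at x)"
    and "(\<lambda>x. frechet_derivative f (at x) v) differentiable (at x)"
    and "continuous_on U (\<lambda>x. frechet_derivative f (at x) v)"
proof -
  have 1: "Ck_on (Suc (Suc 0)) f U" using assms(1) by (simp add: numeral_2_eq_2)
  then show "(f has_derivative frechet_derivative f (at x)) (at x)"
    using assms(2) by (auto simp: frechet_derivative_works)
  have 2: "Ck_on (Suc 0) (\<lambda>x. frechet_derivative f (at x) v) U"
    using 1 unfolding Ck_on.simps(2)[of "Suc 0"] by blast
  then show "(\<lambda>x. frechet_derivative f (at x) v) differentiable (at x)"
    using assms(2) by auto
  show "continuous_on U (\<lambda>x. frechet_derivative f (at x) v)"
    using Ck_on_Suc_imp[OF 2] by simp
qed

section \<open>The energy and its velocity derivative\<close>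

text \<open>The position 0 is an arbitrary choice, justified by \<open>energy_eq\<close>. The square
  makes this the spatial part of \<open>H\<close> up to sign.\<close>

definition energy :: "(real \<Rightarrow> 'a::euclidean_space \<Rightarrow> 'a \<Rightarrow> real) \<Rightarrow> real \<Rightarrow> 'a \<Rightarrow> real" where
  "energy F t v = (F t 0 v)\<^sup>2"

text \<open>This is the covector 2 g_v(v, w), see \<open>fundamental_tensor_momentum\<close>. Taking
  it from the joint derivative in \<open>(t, v)\<close>, in the direction \<open>(0, w)\<close>,
  yields continuity in time and velocity together.\<close>

definition momentum ::
  "(real \<Rightarrow> 'a::euclidean_space \<Rightarrow> 'a \<Rightarrow> real) \<Rightarrow> real \<Rightarrow> 'a \<Rightarrow> 'a \<Rightarrow> real" where
  "momentum F t v w = frechet_derivative (\<lambda>(t, v). energy F t v) (at (t, v)) (0, w)"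

locale time_only_finsler =
  fixes F :: "real \<Rightarrow> 'a::euclidean_space \<Rightarrow> 'a \<Rightarrow> real"
  assumes finsler: "time_dep_finsler F" and time_only: "time_only_dependent F"
begin

lemma energy_eq: "(F t x v)\<^sup>2 = energy F t v"
  using time_only unfolding time_only_dependent_def energy_def by metis

lemma energy_zero: "energy F t 0 = 0"
  using finsler by (simp add: time_dep_finsler_def energy_def)

lemma energy_pos: "v \<noteq> 0 \<Longrightarrow> 0 < energy F t v"
  using finsler unfolding time_dep_finsler_def energy_def by (metis zero_less_power)

lemma energy_scale: "0 < k \<Longrightarrow> energy F t (k *\<^sub>R v) = k\<^sup>2 * energy F t v"
  using finsler by (simp add: time_dep_finsler_def energy_def power_mult_distrib)

lemma energy_Ck: "Ck_on k (\<lambda>(t, v). energy F t v) {(t, v). v \<noteq> 0}"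
proof -
  let ?l = "\<lambda>(t::real, v::'a). (t, 0::'a, v)"
  have op: "open {(t::real, x::'a, v::'a). v \<noteq> 0}" "open {(t::real, v::'a). v \<noteq> 0}"
    unfolding split_beta by (auto intro!: open_Collect_neq continuous_intros)
  have "Ck_on k (\<lambda>(t, x, v). F t x v) {(t, x, v). v \<noteq> 0}"
    using finsler op by (intro smooth_on_openD) (auto simp: time_dep_finsler_def)
  moreover have "bounded_linear ?l"
    unfolding split_beta
    by (intro bounded_linear_Pair bounded_linear_fst bounded_linear_snd bounded_linear_zero)
  ultimately have "Ck_on k (\<lambda>x. (\<lambda>(t, x, v). F t x v) (0 + ?l x))
      ((\<lambda>x. 0 + ?l x) -` {(t, x, v). v \<noteq> 0})"
    using op by (intro Ck_on_compose_affine)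
  moreover have "(\<lambda>x. 0 + ?l x) -` {(t, x, v). v \<noteq> 0} = {(t, v). v \<noteq> 0}"
    by auto
  moreover have "(\<lambda>x. (\<lambda>(t, x, v). F t x v) (0 + ?l x)) = (\<lambda>(t, v). F t 0 v)"
    by auto
  ultimately have "Ck_on k (\<lambda>(t, v). F t 0 v) {(t, v). v \<noteq> 0}"
    by simp
  from Ck_on_scaleR[OF op(2) this this] show ?thesis
    by (simp add: energy_def power2_eq_square case_prod_unfold)
qed

lemma energy_has_derivative:
  assumes "v \<noteq> 0"
  shows "((\<lambda>(t, v). energy F t v) has_derivative
           frechet_derivative (\<lambda>(t, v). energy F t v) (at (t, v))) (at (t, v))"
  by (rule Ck_on_2_derivative(1)[OF energy_Ck]) (use assms in auto)

lemma momentum_linear: "v \<noteq> 0 \<Longrightarrow> linear (momentum F t v)"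
proof -
  assume "v \<noteq> 0"
  then have "linear (frechet_derivative (\<lambda>(t, v). energy F t v) (at (t, v)))"
    using energy_has_derivative has_derivative_linear by blast
  moreover have "linear (\<lambda>w::'a. (0::real, w))"
    by (auto intro!: linearI)
  ultimately show ?thesis
    unfolding momentum_def using linear_compose by (force simp: o_def)
qed

lemma continuous_on_momentum: "continuous_on {(t, v). v \<noteq> 0} (\<lambda>(t, v). momentum F t v w)"
  \<comment> \<open>\<open>Ck_on_2_derivative\<close> asks for a point of the open set; the case
    split below provides one or makes the set empty.\<close>
  using Ck_on_2_derivative(3)[OF energy_Ck, of _ "(0, w)"]
  unfolding momentum_def split_beta 
  by (cases "\<exists>v::'a. v \<noteq> 0") (auto simp: split_beta)

lemma energy_has_derivative_velocity:
  assumes "v \<noteq> 0"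
  shows "((\<lambda>v. energy F t v) has_derivative momentum F t v) (at v)"
proof -
  have "((\<lambda>v. (t, v)) has_derivative (\<lambda>w. (0, w))) (at v)"
    by (auto intro!: derivative_eq_intros)
  from has_derivative_compose[OF this energy_has_derivative[OF assms]]
  show ?thesis by (simp add: momentum_def[abs_def])
qed

lemma energy_line_derivative:
  assumes "v + s *\<^sub>R w \<noteq> 0"
  shows "((\<lambda>s. energy F t (v + s *\<^sub>R w)) has_real_derivative momentum F t (v + s *\<^sub>R w) w) (at s)"
proof -
  have "((\<lambda>s. v + s *\<^sub>R w) has_derivative (\<lambda>r. r *\<^sub>R w)) (at s)"
    by (auto intro!: derivative_eq_intros)
  from has_derivative_compose[OF this energy_has_derivative_velocity[OF assms]]
  show ?thesis
    using linear_scale[OF momentum_linear[OF assms]]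
    by (simp add: has_field_derivative_def mult_commute_abs)
qed

lemma momentum_line_differentiable:
  assumes "v + s *\<^sub>R w \<noteq> 0"
  shows "(\<lambda>s. momentum F t (v + s *\<^sub>R w) u) differentiable (at s)"
proof -
  have "(\<lambda>s. (t, v + s *\<^sub>R w)) differentiable (at s)"
    by (auto simp: differentiable_def intro!: derivative_eq_intros exI)
  moreover have "(\<lambda>x. frechet_derivative (\<lambda>(t, v). energy F t v) (at x) (0, u))
      differentiable (at (t, v + s *\<^sub>R w))"
    by (rule Ck_on_2_derivative(2)[OF energy_Ck]) (use assms in auto)
  ultimately show ?thesis
    unfolding momentum_def
    using differentiable_compose[of "\<lambda>x. frechet_derivative (\<lambda>(t, v). energy F t v) (at x) (0, u)"
        "\<lambda>s. (t, v + s *\<^sub>R w)" s UNIV]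
    by simp
qed

section \<open>Homogeneity of energy and momentum\<close>

lemma momentum_scale:
  assumes "v \<noteq> 0" "0 < k"
  shows "momentum F t (k *\<^sub>R v) w = k * momentum F t v w"
proof -
  have kv: "k *\<^sub>R v \<noteq> 0" using assms by simp
  have "((\<lambda>v. k *\<^sub>R v) has_derivative (\<lambda>w. k *\<^sub>R w)) (at v)"
    by (auto intro!: derivative_eq_intros)
  from has_derivative_compose[OF this energy_has_derivative_velocity[OF kv]]
  have "((\<lambda>v. k\<^sup>2 * energy F t v) has_derivative (\<lambda>w. momentum F t (k *\<^sub>R v) (k *\<^sub>R w))) (at v)"
    using assms(2) by (simp add: energy_scale)
  moreover have "((\<lambda>v. k\<^sup>2 * energy F t v) has_derivative (\<lambda>w. k\<^sup>2 * momentum F t v w)) (at v)"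
    using energy_has_derivative_velocity[OF assms(1)] by (auto intro!: derivative_eq_intros)
  ultimately have "momentum F t (k *\<^sub>R v) (k *\<^sub>R w) = k\<^sup>2 * momentum F t v w"
    using has_derivative_unique by metis
  then show ?thesis
    using assms linear_scale[OF momentum_linear[OF kv]] by (simp add: power2_eq_square)
qed

text \<open>Euler's identity for a function of degree two.\<close>

lemma momentum_self:
  assumes "v \<noteq> 0"
  shows "momentum F t v v = 2 * energy F t v"
proof -
  have "((\<lambda>s. energy F t (v + s *\<^sub>R v)) has_real_derivative momentum F t v v) (at 0)"
    using energy_line_derivative[of v 0 v] assms by simp
  moreover have "((\<lambda>s. (1 + s)\<^sup>2 * energy F t v) has_real_derivative 2 * energy F t v) (at 0)"
    by (auto intro!: derivative_eq_intros)
  then have "((\<lambda>s. energy F t (v + s *\<^sub>R v)) has_real_derivative 2 * energy F t v) (at 0)"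
  \<comment> \<open>Homogeneity holds for positive factors only, so the comparison is restricted to
    \<open>1 + s > 0\<close>.\<close>
  proof (rule has_field_derivative_transform_within_open[of _ _ _ "{-1<..}"])
    fix s :: real assume "s \<in> {-1<..}"
    then show "(1 + s)\<^sup>2 * energy F t v = energy F t (v + s *\<^sub>R v)"
      using energy_scale[of "1 + s" t v] by (simp add: scaleR_left_distrib)
  qed auto
  ultimately show ?thesis
    using DERIV_unique by blast
qed

text \<open>Moving the base point along \<open>v\<close> only rescales it, so by
  \<open>momentum_scale\<close> the inner derivative is
  \<open>(1 + \<delta>) * momentum F t v u\<close>, and the outer one reads off its slope. This
  turns orthogonality to \<open>A\<close> into vanishing of the momentum on tangent vectors.\<close>

lemma fundamental_tensor_momentum:
  assumes "v \<noteq> 0"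
  shows "fundamental_tensor (F t x) v v u = 1/2 * momentum F t v u"
proof -
  have "((\<lambda>\<delta>. (1 + \<delta>) * momentum F t v u) has_real_derivative momentum F t v u) (at 0)"
    by (auto intro!: derivative_eq_intros)
  then have "((\<lambda>\<delta>. deriv (\<lambda>\<eta>. energy F t (v + \<delta> *\<^sub>R v + \<eta> *\<^sub>R u)) 0) has_real_derivative
      momentum F t v u) (at 0)"
  proof (rule has_field_derivative_transform_within_open[of _ _ _ "{-1<..}"])
    fix \<delta> :: real assume d: "\<delta> \<in> {-1<..}"
    have eq: "v + \<delta> *\<^sub>R v = (1 + \<delta>) *\<^sub>R v" by (simp add: scaleR_left_distrib)
    have "(1 + \<delta>) *\<^sub>R v \<noteq> 0" using d assms by auto
    then have "((\<lambda>\<eta>. energy F t ((1 + \<delta>) *\<^sub>R v + \<eta> *\<^sub>R u)) has_real_derivative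
        momentum F t ((1 + \<delta>) *\<^sub>R v) u) (at 0)"
      using energy_line_derivative[of "(1 + \<delta>) *\<^sub>R v" 0 u] by simp
    then show "(1 + \<delta>) * momentum F t v u = deriv (\<lambda>\<eta>. energy F t (v + \<delta> *\<^sub>R v + \<eta> *\<^sub>R u)) 0"
      unfolding eq using d momentum_scale[OF assms, of "1 + \<delta>"] by (simp add: DERIV_imp_deriv)
  qed auto
  then show ?thesis
    by (simp add: fundamental_tensor_def energy_eq DERIV_imp_deriv)
qed

text \<open>Strong convexity enters here: the slope is twice the fundamental tensor at
  \<open>v + s *\<^sub>R w\<close> on \<open>(w, w)\<close>. Hence the energy is strictly convex
  along segments that avoid the zero vector.\<close>

lemma momentum_line_derivative_pos:
  assumes "v + s *\<^sub>R w \<noteq> 0" "w \<noteq> 0"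
  shows "\<exists>d>0. ((\<lambda>s. momentum F t (v + s *\<^sub>R w) w) has_real_derivative d) (at s)"
proof -
  define d where "d = deriv (\<lambda>s. momentum F t (v + s *\<^sub>R w) w) s"
  have D: "((\<lambda>s. momentum F t (v + s *\<^sub>R w) w) has_real_derivative d) (at s)"
    using momentum_line_differentiable[OF assms(1)] unfolding d_def
    by (simp add: DERIV_deriv_iff_real_differentiable)
  let ?v = "v + s *\<^sub>R w"
  \<comment> \<open>The tensor is defined by derivatives at 0, so the line is recentred at
    \<open>s\<close>.\<close>
  have 1: "((\<lambda>\<delta>. momentum F t (v + (s + \<delta>) *\<^sub>R w) w) has_real_derivative d) (at 0)"
    using D by (simp add: DERIV_shift[of _ _ 0 s, simplified] add.commute)
  have "open {\<delta>. ?v + \<delta> *\<^sub>R w \<noteq> 0}"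
    by (intro open_Collect_neq continuous_intros)
  with 1 have "((\<lambda>\<delta>. deriv (\<lambda>\<eta>. energy F t (?v + \<delta> *\<^sub>R w + \<eta> *\<^sub>R w)) 0) has_real_derivative d) (at 0)"
  proof (rule has_field_derivative_transform_within_open)
    fix \<delta> assume "\<delta> \<in> {\<delta>. ?v + \<delta> *\<^sub>R w \<noteq> 0}"
    then have "deriv (\<lambda>\<eta>. energy F t (?v + \<delta> *\<^sub>R w + \<eta> *\<^sub>R w)) 0 = momentum F t (?v + \<delta> *\<^sub>R w) w"
      using energy_line_derivative[of "?v + \<delta> *\<^sub>R w" 0 w t] by (auto intro!: DERIV_imp_deriv)
    then show "momentum F t (v + (s + \<delta>) *\<^sub>R w) w = deriv (\<lambda>\<eta>. energy F t (?v + \<delta> *\<^sub>R w + \<eta> *\<^sub>R w)) 0"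
      by (simp add: algebra_simps)
  qed (use assms in auto)
  then have "fundamental_tensor (F t 0) ?v w w = 1/2 * d"
    by (simp add: fundamental_tensor_def energy_eq DERIV_imp_deriv)
  moreover have "0 < fundamental_tensor (F t 0) ?v w w"
    using finsler assms unfolding time_dep_finsler_def by blast
  ultimately have "0 < d" by linarith
  with D show ?thesis by blast
qed

text \<open>The fundamental inequality: the unit ball meets the hyperplane where
  \<open>momentum F t v\<close> equals 2, tangent to the indicatrix at \<open>v\<close>, only in
  \<open>v\<close>. The slope of the energy increases strictly along the segment from
  \<open>v\<close> to \<open>u\<close>, unless this segment passes through the zero vector, where
  the energy need not be twice differentiable.\<close>

lemma momentum_less:
  assumes "energy F t v = 1" "energy F t u \<le> 1" "u \<noteq> v"
  shows "momentum F t v u < 2"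
proof -
  have v0: "v \<noteq> 0" using assms(1) energy_zero by force
  have lin: "linear (momentum F t v)" by (rule momentum_linear[OF v0])
  show ?thesis
  proof (cases "\<exists>s\<in>{0..1}. v + s *\<^sub>R (u - v) = 0")
    case True
    \<comment> \<open>Here \<open>u\<close> is a nonpositive multiple of \<open>v\<close>, so
      linearity alone decides the sign.\<close>
    then obtain s where s: "0 \<le> s" "s \<le> 1" "(1 - s) *\<^sub>R v + s *\<^sub>R u = 0"
      by (auto simp: algebra_simps)
    then have "s \<noteq> 0" using v0 by auto
    have "0 = momentum F t v ((1 - s) *\<^sub>R v + s *\<^sub>R u)"
      using lin s(3) linear_0 by metis
    also have "\<dots> = (1 - s) * 2 + s * momentum F t v u"
      using momentum_self[OF v0] assms(1) by (simp add: linear_add[OF lin] linear_scale[OF lin])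
    finally have "s * momentum F t v u \<le> 0" using s by auto
    then have "momentum F t v u \<le> 0"
      using s \<open>s \<noteq> 0\<close> by (simp add: mult_le_0_iff)
    then show ?thesis by simp
  next
    case False
    let ?w = "u - v"
    have nz: "v + s *\<^sub>R ?w \<noteq> 0" if "0 \<le> s" "s \<le> 1" for s
      using False that by auto
    obtain \<xi> where xi: "0 < \<xi>" "\<xi> < 1" "energy F t u - energy F t v = momentum F t (v + \<xi> *\<^sub>R ?w) ?w"
      using MVT2[of 0 1 "\<lambda>s. energy F t (v + s *\<^sub>R ?w)" "\<lambda>s. momentum F t (v + s *\<^sub>R ?w) ?w"]
        energy_line_derivative nz by auto
    \<comment> \<open>The mean slope is at most 0, because the energy does not increase from
      \<open>v\<close> to \<open>u\<close>; the slope at the start is strictly smaller.\<close>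
    have "momentum F t (v + 0 *\<^sub>R ?w) ?w < momentum F t (v + \<xi> *\<^sub>R ?w) ?w"
    proof (rule DERIV_pos_imp_increasing[OF xi(1)])
      fix s assume "0 \<le> s" "s \<le> \<xi>"
      then show "\<exists>d. ((\<lambda>s. momentum F t (v + s *\<^sub>R ?w) ?w) has_real_derivative d) (at s) \<and> 0 < d"
        using momentum_line_derivative_pos[of v s ?w t] nz[of s] xi assms(3) by auto
    qed
    then have "momentum F t v ?w < 0"
      using xi assms by auto
    then show ?thesis
      using momentum_self[OF v0] assms(1) by (simp add: linear_diff[OF lin])
  qed
qed

end

section \<open>One-sided derivatives of piecewise smooth curves\<close>

text \<open>Otherwise \<open>g\<close> ends above a rising line through its starting point; but just
  after the last point where it is not above this line, a nonpositive right derivative keeps it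
  below. Since left derivatives do not occur, the argument passes through corners.\<close>

lemma right_derivative_nonpos_imp_le:
  fixes g :: "real \<Rightarrow> real"
  assumes "a \<le> b" "continuous_on {a..b} g"
    and "\<And>t. a \<le> t \<Longrightarrow> t < b \<Longrightarrow> \<exists>D\<le>0. (g has_vector_derivative D) (at_right t)"
  shows "g b \<le> g a"
proof (rule ccontr)
  assume "\<not> g b \<le> g a"
  then have "g a < g b" "a < b" using assms(1) by (auto simp: less_le)
  \<comment> \<open>Half the mean slope, so that the line still ends strictly below
    \<open>g b\<close>.\<close>
  define \<epsilon> where "\<epsilon> = (g b - g a) / (2 * (b - a))"
  define h where "h y = g y - g a - \<epsilon> * (y - a)" for y
  have "0 < \<epsilon>" using \<open>g a < g b\<close> \<open>a < b\<close> by (simp add: \<epsilon>_def)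
  have "h b = (g b - g a) / 2" using \<open>a < b\<close> by (simp add: h_def \<epsilon>_def field_simps)
  then have "0 < h b" using \<open>g a < g b\<close> by simp
  have ch: "continuous_on {a..b} h"
    unfolding h_def by (intro continuous_intros assms(2))
  have "compact ({a..b} \<inter> h -` {..0})"
    by (simp add: compact_eq_bounded_closed continuous_closed_preimage[OF ch] bounded_Int)
  moreover have "a \<in> {a..b} \<inter> h -` {..0}" using \<open>a < b\<close> by (simp add: h_def)
  ultimately obtain c where c: "c \<in> {a..b} \<inter> h -` {..0}" "\<And>y. y \<in> {a..b} \<inter> h -` {..0} \<Longrightarrow> y \<le> c"
    using compact_attains_sup by (metis empty_iff)
  then have "a \<le> c" "c < b" "h c \<le> 0" using \<open>0 < h b\<close> by (auto simp: less_le)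
  then obtain D where "D \<le> 0" "(g has_vector_derivative D) (at_right c)"
    using assms(3) by blast
  then have "(h has_vector_derivative D - \<epsilon>) (at_right c)"
    unfolding h_def by (auto intro!: derivative_eq_intros)
  then have "((\<lambda>y. (h y - h c) / (y - c)) \<longlongrightarrow> D - \<epsilon>) (at_right c)"
    by (simp add: has_real_derivative_iff_has_vector_derivative[symmetric] has_field_derivative_iff)
  then have "\<forall>\<^sub>F y in at_right c. (h y - h c) / (y - c) < 0"
    by (rule order_tendstoD) (use \<open>D \<le> 0\<close> \<open>0 < \<epsilon>\<close> in simp)
  moreover have "\<forall>\<^sub>F y in at_right c. y \<in> {c<..<b}"
    by (rule eventually_at_right_real[OF \<open>c < b\<close>])
  ultimately have "\<forall>\<^sub>F y in at_right c. False"
  proof eventually_elim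
    case (elim y)
    then have "h y < h c" by (auto simp: divide_less_0_iff)
    then show False using c(2)[of y] elim \<open>a \<le> c\<close> \<open>h c \<le> 0\<close> by auto
  qed
  then show False by simp
qed

text \<open>The right derivative at \<open>a\<close> yields one strict drop, and the weak version
  preserves it up to \<open>b\<close>.\<close>

lemma right_derivative_neg_imp_less:
  fixes g :: "real \<Rightarrow> real"
  assumes "a < b" "continuous_on {a..b} g"
    and "\<And>t. a \<le> t \<Longrightarrow> t < b \<Longrightarrow> \<exists>D<0. (g has_vector_derivative D) (at_right t)"
  shows "g b < g a"
proof -
  obtain D where "D < 0" "(g has_vector_derivative D) (at_right a)"
    using assms(3)[of a] assms(1) by auto
  then have "((\<lambda>y. (g y - g a) / (y - a)) \<longlongrightarrow> D) (at_right a)"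
    by (simp add: has_real_derivative_iff_has_vector_derivative[symmetric] has_field_derivative_iff)
  then have "\<forall>\<^sub>F y in at_right a. (g y - g a) / (y - a) < 0"
    by (rule order_tendstoD) fact
  moreover have "\<forall>\<^sub>F y in at_right a. y \<in> {a<..<b}"
    by (rule eventually_at_right_real[OF \<open>a < b\<close>])
  ultimately have "\<forall>\<^sub>F y in at_right a. y \<in> {a<..<b} \<and> (g y - g a) / (y - a) < 0"
    by eventually_elim simp
  then obtain y where y: "a < y" "y < b" "(g y - g a) / (y - a) < 0"
    using eventually_happens'[of "at_right a"] by fastforce
  have "g b \<le> g y"
  proof (rule right_derivative_nonpos_imp_le[of y b g])
    show "continuous_on {y..b} g" by (rule continuous_on_subset[OF assms(2)]) (use y in auto)
    show "\<exists>D\<le>0. (g has_vector_derivative D) (at_right t)" if "y \<le> t" "t < b" for t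
      using assms(3)[of t] that y by (auto intro: less_imp_le)
  qed (use y in simp)
  then show ?thesis using y by (simp add: divide_less_0_iff)
qed

lemma right_derivative_zero_imp_eq:
  fixes g :: "real \<Rightarrow> 'a::euclidean_space"
  assumes "a \<le> b" "continuous_on {a..b} g"
    and "\<And>t. a \<le> t \<Longrightarrow> t < b \<Longrightarrow> (g has_vector_derivative 0) (at_right t)"
  shows "g a = g b"
proof (rule vector_eq_rdot[THEN iffD1], intro allI)
  fix e
  have le: "g b \<bullet> e \<le> g a \<bullet> e" for e
  proof (rule right_derivative_nonpos_imp_le[OF assms(1), of "\<lambda>t. g t \<bullet> e"])
    show "continuous_on {a..b} (\<lambda>t. g t \<bullet> e)"
      by (intro continuous_intros assms(2))
    show "\<exists>D\<le>0. ((\<lambda>t. g t \<bullet> e) has_vector_derivative D) (at_right t)" if "a \<le> t" "t < b" for t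
      using bounded_linear.has_vector_derivative[OF bounded_linear_inner_left assms(3)[OF that], of e]
      by auto
  qed
  show "g a \<bullet> e = g b \<bullet> e" using le[of e] le[of "- e"] by simp
qed

section \<open>One-sided derivatives and velocities on a piece\<close>

lemma at_within_atLeast_eq: "at x within {x..} = at_right (x::real)"
proof -
  have "{x..} - {x} = {x<..} - {x}" by auto
  then show ?thesis unfolding at_within_def by simp
qed

lemma has_vector_derivative_right_unique:
  assumes "(c has_vector_derivative u) (at_right (s::real))" "(c has_vector_derivative w) (at_right s)"
  shows "u = w"
  by (rule vector_derivative_unique_within[OF _ assms]) simp

lemma has_vector_derivative_piece_right:
  assumes "(c has_vector_derivative w) (at s within {a..b})" "a \<le> s" "s < (b::real)"
  shows "(c has_vector_derivative w) (at_right s)"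
proof -
  have "(c has_vector_derivative w) (at s within {s..b})"
    by (rule has_vector_derivative_within_subset[OF assms(1)]) (use assms in auto)
  then show ?thesis by (simp add: at_within_Icc_at_right[OF assms(3)])
qed

lemma has_vector_derivative_piece_left:
  assumes "(c has_vector_derivative w) (at s within {a..b})" "a < s" "s \<le> (b::real)"
  shows "(c has_vector_derivative w) (at_left s)"
proof -
  have "(c has_vector_derivative w) (at s within {a..s})"
    by (rule has_vector_derivative_within_subset[OF assms(1)]) (use assms in auto)
  then show ?thesis by (simp add: at_within_Icc_at_left[OF assms(2)])
qed

lemma velocities_piece:
  assumes "(c has_vector_derivative w) (at s within {a..b})" "a < b" "s \<in> {a..b}" "{a..b} \<subseteq> I"
  shows "w \<in> velocities I c s"
proof (cases "s < b")
  case True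
  then have "(c has_vector_derivative w) (at_right s)"
    using has_vector_derivative_piece_right assms(1,3) by auto
  moreover have "b \<in> I" using assms(2,4) by (simp add: subset_iff)
  ultimately show ?thesis unfolding velocities_def using True by blast
next
  case False
  then have "a < s" "s \<le> b" using assms by auto
  then have "(c has_vector_derivative w) (at_left s)"
    using has_vector_derivative_piece_left assms(1) by blast
  moreover have "a \<in> I" using assms(2,4) by (simp add: subset_iff)
  ultimately show ?thesis unfolding velocities_def using \<open>a < s\<close> by blast
qed

text \<open>The derivative of a smooth extension, restricted to the piece. One continuous
  \<open>c'\<close> per closed piece supplies the velocity on each side of a break, where a
  two-sided derivative may fail to exist.\<close>

lemma smooth_on_piece_derivative:
  fixes c :: "real \<Rightarrow> 'a::euclidean_space"
  assumes "smooth_on c {a..b}"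
  obtains c' where "continuous_on {a..b} c'"
    "\<And>s. s \<in> {a..b} \<Longrightarrow> (c has_vector_derivative c' s) (at s within {a..b})"
proof -
  obtain U g where U: "{a..b} \<subseteq> U" "Ck_on 2 g U" "\<forall>s\<in>{a..b}. g s = c s"
    using assms unfolding smooth_on_def by blast
  define c' where "c' s = frechet_derivative g (at s) 1" for s
  have "(c has_vector_derivative c' s) (at s within {a..b})" if "s \<in> {a..b}" for s
  proof -
    have D: "(g has_derivative frechet_derivative g (at s)) (at s)"
      using Ck_on_2_derivative(1)[OF U(2)] U(1) that by blast
    have "frechet_derivative g (at s) x = x *\<^sub>R c' s" for x
      using linear_scale[OF has_derivative_linear[OF D], of x 1] by (simp add: c'_def)
    then have "frechet_derivative g (at s) = (\<lambda>x. x *\<^sub>R c' s)" by (rule ext)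
    with D have "(g has_vector_derivative c' s) (at s)"
      by (simp add: has_vector_derivative_def)
    then show ?thesis
      by (rule has_vector_derivative_transform[OF that _ has_vector_derivative_at_within, rotated])
        (use U in auto)
  qed
  moreover have "continuous_on {a..b} c'"
  proof (cases "{a..b} = {}")
    case False
    then obtain s where "s \<in> U" using U(1) by blast
    from Ck_on_2_derivative(3)[OF U(2) this] show ?thesis
      unfolding c'_def using continuous_on_subset U(1) by blast
  qed simp
  ultimately show ?thesis using that by blast
qed

section \<open>Partitions and piecewise smooth curves\<close>

lemma partition_of_mono:
  assumes "partition_of a b m p" "i \<le> j" "j \<le> m"
  shows "p i \<le> p j"
  using assms(2,3)
proof (induction rule: dec_induct)
  case (step k)
  then show ?case using assms(1) unfolding partition_of_def
    by (metis Suc_le_lessD Suc_leD less_imp_le order_trans)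
qed simp

lemma partition_of_bounds:
  assumes "partition_of a b m p" "i \<le> m"
  shows "a \<le> p i" "p i \<le> b"
  using partition_of_mono[OF assms(1), of 0 i] partition_of_mono[OF assms(1), of i m] assms
  by (auto simp: partition_of_def)

lemma partition_of_step: "partition_of a b m p \<Longrightarrow> i < m \<Longrightarrow> p i < p (Suc i)"
  by (simp add: partition_of_def)

text \<open>Strictness at the upper end leaves room to the right of \<open>s\<close>, as right
  derivatives require; the price is that \<open>b\<close> itself is not covered.\<close>

lemma partition_of_piece:
  assumes "partition_of a b m p" "a \<le> s" "s < b"
  obtains i where "i < m" "p i \<le> s" "s < p (Suc i)"
proof -
  have "p 0 \<le> s" "s < p m" using assms by (auto simp: partition_of_def)
  then obtain i where "i < m" "\<not> s < p i" "s < p (Suc i)"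
    using ex_least_nat_less[of "\<lambda>i. s < p i" m]
    by (metis lessI linorder_not_less order_refl)
  then show ?thesis using that by auto
qed

lemma partition_of_pos: "partition_of a b m p \<Longrightarrow> a < b \<Longrightarrow> 0 < m"
  by (cases m) (auto simp: partition_of_def)

lemma piecewise_smooth_on_continuous:
  assumes "piecewise_smooth_on I c" "a < b" "{a..b} \<subseteq> I"
  shows "continuous_on {a..b} c"
proof -
  obtain m p where p: "partition_of a b m p" "\<forall>i<m. smooth_on c {p i..p (Suc i)}"
    using assms unfolding piecewise_smooth_on_def by blast
  have "continuous_on {p i..p (Suc i)} c" if i: "i < m" for i
  proof -
    obtain c' where "\<And>s. s \<in> {p i..p (Suc i)} \<Longrightarrow> (c has_vector_derivative c' s) (at s within {p i..p (Suc i)})"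
      using smooth_on_piece_derivative[OF p(2)[rule_format, OF i]] by blast
    then show ?thesis
      by (intro continuous_on_vector_derivative) blast
  qed
  then have "continuous_on (\<Union>i\<in>{..<m}. {p i..p (Suc i)}) c"
    by (intro continuous_on_closed_Union) auto
  moreover have "{a..b} \<subseteq> (\<Union>i\<in>{..<m}. {p i..p (Suc i)})"
  proof
    fix s assume s: "s \<in> {a..b}"
    show "s \<in> (\<Union>i\<in>{..<m}. {p i..p (Suc i)})"
    proof (cases "s = b")
      case True
      have "0 < m" using partition_of_pos p(1) assms(2) by blast
      then have "b \<in> {p (m - 1)..p (Suc (m - 1))}"
        using p(1) partition_of_step[OF p(1), of "m - 1"] by (auto simp: partition_of_def)
      then show ?thesis using True \<open>0 < m\<close> by (intro UN_I[of "m - 1"]) auto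
    next
      case False
      with s have "a \<le> s" "s < b" by auto
      then obtain i where "i < m" "p i \<le> s" "s < p (Suc i)"
        using partition_of_piece[OF p(1)] by metis
      then show ?thesis by (intro UN_I[of i]) auto
    qed
  qed
  ultimately show ?thesis using continuous_on_subset by blast
qed

lemma piecewise_smooth_on_right_derivative:
  assumes "piecewise_smooth_on I c" "a < b" "{a..b} \<subseteq> I"
  shows "\<exists>w. (c has_vector_derivative w) (at_right a)"
proof -
  obtain m p where p: "partition_of a b m p" "\<forall>i<m. smooth_on c {p i..p (Suc i)}"
    using assms unfolding piecewise_smooth_on_def by blast
  have "0 < m" by (rule partition_of_pos) fact+
  have pp: "p 0 = a" "p 0 < p (Suc 0)" using p(1) \<open>0 < m\<close> by (auto simp: partition_of_def)
  obtain c' where c': "\<And>s. s \<in> {p 0..p (Suc 0)} \<Longrightarrow> (c has_vector_derivative c' s) (at s within {p 0..p (Suc 0)})"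
    using smooth_on_piece_derivative[OF p(2)[rule_format, OF \<open>0 < m\<close>]] by blast
  have "(c has_vector_derivative c' a) (at_right a)"
    by (rule has_vector_derivative_piece_right[of _ _ _ "p 0" "p (Suc 0)"]) (use c' pp in auto)
  then show ?thesis by blast
qed

lemma piecewise_smooth_on_left_derivative:
  assumes "piecewise_smooth_on I c" "a < b" "{a..b} \<subseteq> I"
  shows "\<exists>w. (c has_vector_derivative w) (at_left b)"
proof -
  obtain m p where p: "partition_of a b m p" "\<forall>i<m. smooth_on c {p i..p (Suc i)}"
    using assms unfolding piecewise_smooth_on_def by blast
  have "0 < m" by (rule partition_of_pos) fact+
  define i where "i = m - 1"
  then have i: "i < m" "Suc i = m" using \<open>0 < m\<close> by simp_all
  then have pp: "p (Suc i) = b" "p i < p (Suc i)"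
    using p(1) partition_of_step[OF p(1) i(1)] by (simp_all add: partition_of_def)
  obtain c' where c': "\<And>s. s \<in> {p i..p (Suc i)} \<Longrightarrow> (c has_vector_derivative c' s) (at s within {p i..p (Suc i)})"
    using smooth_on_piece_derivative[OF p(2)[rule_format, OF i(1)]] by blast
  have "(c has_vector_derivative c' b) (at_left b)"
    by (rule has_vector_derivative_piece_left[of _ _ _ "p i" "p (Suc i)"]) (use c' pp in auto)
  then show ?thesis by blast
qed

lemma velocities_right:
  assumes "(c has_vector_derivative w) (at_right s)" "r \<in> I" "s < r"
  shows "w \<in> velocities I c s"
  unfolding velocities_def using assms by blast

section \<open>Increasing reparametrizations\<close>

lemma positive_velocities_imp_strict_mono_on:
  fixes \<theta> :: "real \<Rightarrow> real"
  assumes "is_interval J" "piecewise_smooth_on J \<theta>" "\<forall>s\<in>J. \<forall>w\<in>velocities J \<theta> s. 0 < w"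
  shows "strict_mono_on J \<theta>"
proof (rule strict_mono_onI)
  fix a b assume ab: "a \<in> J" "b \<in> J" "a < b"
  then have sub: "{a..b} \<subseteq> J"
    using interval_subset_is_interval[OF assms(1), of a b] by simp
  have "- \<theta> b < - \<theta> a"
  proof (rule right_derivative_neg_imp_less[OF \<open>a < b\<close>, of "\<lambda>s. - \<theta> s"])
    show "continuous_on {a..b} (\<lambda>s. - \<theta> s)"
      by (intro continuous_on_minus piecewise_smooth_on_continuous[OF assms(2) ab(3) sub])
    fix t assume t: "a \<le> t" "t < b"
    then have sub': "{t..b} \<subseteq> J" using sub by auto
    obtain w where w: "(\<theta> has_vector_derivative w) (at_right t)"
      using piecewise_smooth_on_right_derivative[OF assms(2) t(2) sub'] by blast
    then have "0 < w" using velocities_right[OF w ab(2) t(2)] assms(3) sub t by (auto simp: subset_iff)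
    moreover have "((\<lambda>s. - \<theta> s) has_vector_derivative - w) (at_right t)"
      by (rule has_vector_derivative_minus[OF w])
    ultimately show "\<exists>D<0. ((\<lambda>s. - \<theta> s) has_vector_derivative D) (at_right t)"
      by (intro exI[of _ "- w"]) auto
  qed
  then show "\<theta> a < \<theta> b" by simp
qed

text \<open>Monotonicity keeps the image of \<open>{s..r}\<close> in \<open>{\<theta> s..}\<close>,
  where a right derivative of \<open>c\<close> is all that the chain rule asks for.\<close>

lemma right_derivative_compose:
  fixes c :: "real \<Rightarrow> 'a::real_normed_vector"
  assumes "(\<theta> has_vector_derivative \<tau>) (at_right s)" "(c has_vector_derivative u) (at_right (\<theta> s))"
    and "s < r" "\<And>y. s \<le> y \<Longrightarrow> y \<le> r \<Longrightarrow> \<theta> s \<le> \<theta> y"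
  shows "((c \<circ> \<theta>) has_vector_derivative \<tau> *\<^sub>R u) (at_right s)"
proof -
  have "(\<theta> has_vector_derivative \<tau>) (at s within {s..r})"
    using assms(1) by (simp add: at_within_Icc_at_right[OF assms(3)])
  moreover have "(c has_vector_derivative u) (at (\<theta> s) within \<theta> ` {s..r})"
    by (rule has_vector_derivative_within_subset[where S = "{\<theta> s..}"])
      (use assms(2,4) in \<open>simp_all add: at_within_atLeast_eq image_subset_iff\<close>)
  ultimately show ?thesis
    using vector_diff_chain_within at_within_Icc_at_right[OF assms(3)] by metis
qed

lemma left_derivative_compose:
  fixes c :: "real \<Rightarrow> 'a::real_normed_vector"
  assumes "(\<theta> has_vector_derivative \<tau>) (at_left s)" "(c has_vector_derivative u) (at_left (\<theta> s))"
    and "r < s" "\<And>y. r \<le> y \<Longrightarrow> y \<le> s \<Longrightarrow> \<theta> y \<le> \<theta> s"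
  shows "((c \<circ> \<theta>) has_vector_derivative \<tau> *\<^sub>R u) (at_left s)"
proof -
  have "(\<theta> has_vector_derivative \<tau>) (at s within {r..s})"
    using assms(1) by (simp add: at_within_Icc_at_left[OF assms(3)])
  moreover have "(c has_vector_derivative u) (at (\<theta> s) within \<theta> ` {r..s})"
  proof -
    have "{..\<theta> s} - {\<theta> s} = {..<\<theta> s} - {\<theta> s}" by auto
    then have "at (\<theta> s) within {..\<theta> s} = at_left (\<theta> s)" unfolding at_within_def by simp
    then show ?thesis
      using has_vector_derivative_within_subset[of c u "\<theta> s" "{..\<theta> s}" "\<theta> ` {r..s}"] assms(2,4)
      by (simp add: image_subset_iff)
  qed
  ultimately show ?thesis
    using vector_diff_chain_within at_within_Icc_at_left[OF assms(3)] by metis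
qed

section \<open>Conservation of momentum\<close>

lemma smooth_on_subset: "smooth_on f S \<Longrightarrow> T \<subseteq> S \<Longrightarrow> smooth_on f T"
  unfolding smooth_on_def by blast

text \<open>An affine profile extends beyond the piece by its own formula, next to the extension of
  \<open>\<sigma>\<close> that smoothness provides.\<close>

lemma smooth_on_affine_variation:
  fixes \<sigma> :: "real \<Rightarrow> 'a::euclidean_space"
  assumes "smooth_on \<sigma> S" "\<And>s. s \<in> S \<Longrightarrow> h s = \<alpha> + \<beta> * s"
  shows "smooth_on (\<lambda>(\<omega>, s). \<sigma> s + (\<omega> * h s) *\<^sub>R w) (I \<times> S)"
proof -
  obtain U g where U: "open U" "S \<subseteq> U" "\<And>k. Ck_on k g U" "\<And>x. x \<in> S \<Longrightarrow> g x = \<sigma> x"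
    using assms(1) unfolding smooth_on_def by blast
  let ?G = "\<lambda>x::real \<times> real. g (snd x) + (fst x * (\<alpha> + \<beta> * snd x)) *\<^sub>R w"
  have op: "open (UNIV \<times> U :: (real \<times> real) set)"
    by (intro open_Times open_UNIV U(1))
  have pre: "(\<lambda>x::real \<times> real. 0 + snd x) -` U = UNIV \<times> U"
    by auto
  have "Ck_on k (\<lambda>x::real \<times> real. g (0 + snd x)) (UNIV \<times> U)" for k
    using Ck_on_compose_affine[where l = "snd :: real \<times> real \<Rightarrow> real", OF U(1) bounded_linear_snd U(3), of k 0]
    unfolding pre .
  then have "Ck_on k (\<lambda>x::real \<times> real. g (snd x)) (UNIV \<times> U)" for k
    by simp
  then have "Ck_on k ?G (UNIV \<times> U)" for k
    by (rule Ck_on_add[OF op]) (rule Ck_on_subset[OF Ck_on_bilinear subset_UNIV])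
  moreover have "I \<times> S \<subseteq> UNIV \<times> U" using U(2) by auto
  moreover have "\<forall>x\<in>I \<times> S. ?G x = (\<lambda>(\<omega>, s). \<sigma> s + (\<omega> * h s) *\<^sub>R w) x"
    using assms(2) U(4) by auto
  ultimately show ?thesis
    unfolding smooth_on_def using op by blast
qed

context time_only_finsler
begin

section \<open>First variation under spatial perturbations\<close>

lemma continuous_on_energy:
  assumes "continuous_on S T" "continuous_on S Y"
  shows "continuous_on S (\<lambda>s. energy F (T s) (Y s))"
proof -
  have "continuous_on UNIV (\<lambda>(t, x, v). F t x v)"
    using finsler by (simp add: time_dep_finsler_def)
  from continuous_on_compose2[OF this, of S "\<lambda>s. (T s, 0, Y s)"]
  have "continuous_on S (\<lambda>s. F (T s) 0 (Y s))"
    using assms by (simp add: continuous_on_Pair)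
  then show ?thesis unfolding energy_def by (rule continuous_on_power)
qed

lemma continuous_on_momentum_compose:
  assumes "continuous_on S T" "continuous_on S Y" "\<And>s. s \<in> S \<Longrightarrow> Y s \<noteq> 0"
  shows "continuous_on S (\<lambda>s. momentum F (T s) (Y s) w)"
  using continuous_on_compose2[OF continuous_on_momentum, of S "\<lambda>s. (T s, Y s)" w] assms
  by (simp add: continuous_on_Pair image_subset_iff)

text \<open>Differentiation under the integral sign. \<open>T\<close> is the time component, which
  the variation does not touch, and \<open>\<kappa>\<close> is the slope of the profile; a displaced
  position leaves no trace because the energy does not depend on it.\<close>

lemma action_piece_derivative:
  fixes T T' :: "real \<Rightarrow> real" and Y :: "real \<Rightarrow> 'a"
  assumes T: "continuous_on {a..b} T" and T': "continuous_on {a..b} T'"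
    and Y: "continuous_on {a..b} Y" "\<And>s. s \<in> {a..b} \<Longrightarrow> Y s \<noteq> 0"
  shows "((\<lambda>\<omega>. integral {a..b} (\<lambda>s. (T' s)\<^sup>2 - energy F (T s) (Y s + (\<omega> * \<kappa>) *\<^sub>R w)))
           has_real_derivative - \<kappa> * integral {a..b} (\<lambda>s. momentum F (T s) (Y s) w)) (at 0)"
proof -
  obtain \<mu> where mu: "0 < \<mu>" "\<And>s. s \<in> {a..b} \<Longrightarrow> \<mu> \<le> norm (Y s)"
  proof (cases "{a..b} = {}")
    case True then show ?thesis using that[of 1] by simp
  next
    case False
    obtain s0 where "s0 \<in> {a..b}" "\<forall>s\<in>{a..b}. norm (Y s0) \<le> norm (Y s)"
      using continuous_attains_inf[OF compact_Icc[of a b], of "\<lambda>s. norm (Y s)"] continuous_on_norm[OF Y(1)] False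
      by blast
    then show ?thesis using that[of "norm (Y s0)"] Y(2) by simp
  qed
  \<comment> \<open>For variation parameters below \<open>\<delta>\<close> in absolute value the
    perturbation is shorter than the lower bound \<open>\<mu>\<close> of the speed, so the velocity
    never meets zero, where smoothness of the energy may fail. The summand 1 avoids a division by
    0.\<close>
  define \<delta> where "\<delta> = \<mu> / (\<bar>\<kappa>\<bar> * norm w + 1)"
  have k: "0 < \<bar>\<kappa>\<bar> * norm w + 1" by (simp add: add_nonneg_pos)
  then have "0 < \<delta>" using mu(1) by (simp add: \<delta>_def)
  let ?U = "{-\<delta><..<\<delta>}"
  have nz: "Y s + (\<omega> * \<kappa>) *\<^sub>R w \<noteq> 0" if "\<omega> \<in> ?U" "s \<in> {a..b}" for \<omega> s
  proof
    assume "Y s + (\<omega> * \<kappa>) *\<^sub>R w = 0"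
    then have "Y s = - ((\<omega> * \<kappa>) *\<^sub>R w)" by (simp add: add_eq_0_iff2)
    then have "norm (Y s) = \<bar>\<omega>\<bar> * (\<bar>\<kappa>\<bar> * norm w)" by (simp add: abs_mult)
    also have "\<dots> \<le> \<bar>\<omega>\<bar> * (\<bar>\<kappa>\<bar> * norm w + 1)" by (rule mult_left_mono) simp_all
    also have "\<dots> < \<delta> * (\<bar>\<kappa>\<bar> * norm w + 1)" using that(1) k by (intro mult_strict_right_mono) auto
    also have "\<dots> = \<mu>" using k by (simp add: \<delta>_def)
    finally show False using mu(2)[OF that(2)] by simp
  qed
  have "((\<lambda>\<omega>. integral (cbox a b) (\<lambda>s. (T' s)\<^sup>2 - energy F (T s) (Y s + (\<omega> * \<kappa>) *\<^sub>R w)))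
      has_real_derivative integral (cbox a b) (\<lambda>s. - \<kappa> * momentum F (T s) (Y s + (0 * \<kappa>) *\<^sub>R w) w))
      (at 0 within ?U)"
  proof (rule leibniz_rule_field_derivative[where fx = "\<lambda>\<omega> s. - \<kappa> * momentum F (T s) (Y s + (\<omega> * \<kappa>) *\<^sub>R w) w"])
    fix \<omega> s assume *: "\<omega> \<in> ?U" "s \<in> cbox a b"
    have "((\<lambda>\<omega>. \<omega> * \<kappa>) has_real_derivative \<kappa>) (at \<omega> within ?U)"
      by (auto intro!: derivative_eq_intros)
    moreover have "((\<lambda>r. energy F (T s) (Y s + r *\<^sub>R w)) has_real_derivative
        momentum F (T s) (Y s + (\<omega> * \<kappa>) *\<^sub>R w) w) (at (\<omega> * \<kappa>))"
      by (rule energy_line_derivative) (rule nz, use * in auto)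
    ultimately have "((\<lambda>\<omega>. energy F (T s) (Y s + (\<omega> * \<kappa>) *\<^sub>R w)) has_real_derivative
        momentum F (T s) (Y s + (\<omega> * \<kappa>) *\<^sub>R w) w * \<kappa>) (at \<omega> within ?U)"
      using DERIV_chain2[where f = "\<lambda>r. energy F (T s) (Y s + r *\<^sub>R w)" and g = "\<lambda>\<omega>. \<omega> * \<kappa>"]
      by simp
    from DERIV_diff[OF DERIV_const this, of "(T' s)\<^sup>2"]
    show "((\<lambda>\<omega>. (T' s)\<^sup>2 - energy F (T s) (Y s + (\<omega> * \<kappa>) *\<^sub>R w)) has_real_derivative
        - \<kappa> * momentum F (T s) (Y s + (\<omega> * \<kappa>) *\<^sub>R w) w) (at \<omega> within ?U)"
      by (simp add: mult.commute)
  next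
    fix \<omega> :: real
    have "continuous_on {a..b} (\<lambda>s. (T' s)\<^sup>2 - energy F (T s) (Y s + (\<omega> * \<kappa>) *\<^sub>R w))"
      by (intro continuous_on_diff continuous_on_power T' continuous_on_energy T continuous_on_add Y(1)
          continuous_on_const)
    then show "(\<lambda>s. (T' s)\<^sup>2 - energy F (T s) (Y s + (\<omega> * \<kappa>) *\<^sub>R w)) integrable_on cbox a b"
      by (simp add: integrable_continuous_real)
  next
    have snd: "continuous_on (?U \<times> cbox a b) (\<lambda>x. h (snd x))" if "continuous_on {a..b} h"
      for h :: "real \<Rightarrow> 'c::topological_space"
      by (rule continuous_on_compose2[OF that continuous_on_snd[OF continuous_on_id]]) auto
    have "continuous_on (?U \<times> cbox a b)
        (\<lambda>x. - \<kappa> * momentum F (T (snd x)) (Y (snd x) + (fst x * \<kappa>) *\<^sub>R w) w)"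
      by (intro continuous_on_mult continuous_on_const continuous_on_momentum_compose snd[OF T]
          continuous_on_add snd[OF Y(1)] continuous_on_scaleR continuous_on_fst continuous_on_id)
        (use nz in auto)
    then show "continuous_on (?U \<times> cbox a b)
        (\<lambda>(\<omega>, s). - \<kappa> * momentum F (T s) (Y s + (\<omega> * \<kappa>) *\<^sub>R w) w)"
      by (simp add: case_prod_unfold)
  qed (use \<open>0 < \<delta>\<close> in auto)
  then show ?thesis
    using \<open>0 < \<delta>\<close> by (simp add: at_within_open[of 0 ?U] box_real)
qed

text \<open>In the interior the perturbation adds a constant to the spatial velocity and nothing to
  the time component. The end points, where \<open>vector_derivative\<close> need not agree with the
  velocity of the piece, are ignored by the integral.\<close>

lemma affine_variation_action:
  fixes \<sigma> :: "real \<Rightarrow> real \<times> 'a"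
  assumes c: "\<And>s. s \<in> {a..b} \<Longrightarrow> (\<sigma> has_vector_derivative c s) (at s within {a..b})"
    and cc: "continuous_on {a..b} c"
    and h: "\<And>s. s \<in> {a..b} \<Longrightarrow> h s = \<alpha> + \<kappa> * s"
    and \<Gamma>: "\<Gamma> = (\<lambda>s. \<sigma> s + (\<omega> * h s) *\<^sub>R (0, w))"
  shows "((\<lambda>s. lorentz_finsler F (\<Gamma> s) (vector_derivative \<Gamma> (at s))) has_integral
           integral {a..b} (\<lambda>s. (fst (c s))\<^sup>2 - energy F (fst (\<sigma> s)) (snd (c s) + (\<omega> * \<kappa>) *\<^sub>R w))) {a..b}"
proof -
  let ?I = "\<lambda>s. (fst (c s))\<^sup>2 - energy F (fst (\<sigma> s)) (snd (c s) + (\<omega> * \<kappa>) *\<^sub>R w)"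
  have "continuous_on {a..b} \<sigma>"
    using c by (rule continuous_on_vector_derivative)
  then have "continuous_on {a..b} ?I"
    by (intro continuous_on_diff continuous_on_power continuous_on_energy continuous_on_add
        continuous_on_const continuous_on_fst continuous_on_snd cc)
  then have "(?I has_integral integral {a..b} ?I) (cbox a b)"
    by (simp add: integrable_continuous_real integrable_integral)
  moreover have "lorentz_finsler F (\<Gamma> s) (vector_derivative \<Gamma> (at s)) = ?I s" if "s \<in> box a b" for s
  proof -
    have s: "s \<in> {a<..<b}" using that by simp
    have "(\<sigma> has_vector_derivative c s) (at s within {a<..<b})"
      by (rule has_vector_derivative_within_subset[OF c[of s]]) (use s in auto)
    then have \<sigma>': "(\<sigma> has_vector_derivative c s) (at s)"
      using s by (simp add: at_within_open[of s "{a<..<b}"])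
    have "((\<lambda>r. \<sigma> r + (\<omega> * (\<alpha> + \<kappa> * r)) *\<^sub>R (0, w)) has_vector_derivative
        c s + (\<omega> * \<kappa>) *\<^sub>R (0, w)) (at s)"
      by (rule has_vector_derivative_add[OF \<sigma>']) (auto intro!: derivative_eq_intros)
    then have "(\<Gamma> has_vector_derivative c s + (\<omega> * \<kappa>) *\<^sub>R (0, w)) (at s)"
      by (rule has_vector_derivative_transform_within_open[of _ _ _ "{a<..<b}"])
        (use s h \<Gamma> in auto)
    then have "vector_derivative \<Gamma> (at s) = c s + (\<omega> * \<kappa>) *\<^sub>R (0, w)"
      by (rule vector_derivative_at)
    then show ?thesis
      by (simp add: \<Gamma> lorentz_finsler_def case_prod_unfold energy_eq)
  qed
  ultimately have "((\<lambda>s. lorentz_finsler F (\<Gamma> s) (vector_derivative \<Gamma> (at s))) has_integral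
      integral {a..b} ?I) (cbox a b)"
    by (rule has_integral_spike_interior)
  then show ?thesis by simp
qed

text \<open>The variation that moves the point at \<open>m\<close> in direction \<open>w\<close>, with affine decay to \<open>a\<close> and \<open>b\<close>,
  compares the mean momenta on the two sides of \<open>m\<close>.\<close>

lemma critical_curve_mean_momentum:
  fixes \<sigma> :: "real \<Rightarrow> real \<times> 'a"
  assumes "a < m" "m < b" "smooth_on \<sigma> {a..m}" "smooth_on \<sigma> {m..b}"
    and c: "\<And>s. s \<in> {a..m} \<Longrightarrow> (\<sigma> has_vector_derivative c s) (at s within {a..m})"
      "continuous_on {a..m} c" "\<And>s. s \<in> {a..m} \<Longrightarrow> snd (c s) \<noteq> 0"
    and d: "\<And>s. s \<in> {m..b} \<Longrightarrow> (\<sigma> has_vector_derivative d s) (at s within {m..b})"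
      "continuous_on {m..b} d" "\<And>s. s \<in> {m..b} \<Longrightarrow> snd (d s) \<noteq> 0"
    and crit: "critical_curve (lorentz_finsler F) a b \<sigma>"
  shows "integral {a..m} (\<lambda>s. momentum F (fst (\<sigma> s)) (snd (c s)) w) / (m - a) =
         integral {m..b} (\<lambda>s. momentum F (fst (\<sigma> s)) (snd (d s)) w) / (b - m)"
proof -
  \<comment> \<open>The tent profile: 0 at \<open>a\<close> and \<open>b\<close>, 1 at
    \<open>m\<close>, with slopes \<open>\<kappa>\<close> and \<open>\<nu>\<close>.\<close>
  define h where "h s = (if s \<le> m then (s - a) / (m - a) else (b - s) / (b - m))" for s
  define \<kappa> where "\<kappa> = 1 / (m - a)"
  define \<nu> where "\<nu> = - (1 / (b - m))"
  define \<Gamma> where "\<Gamma> \<omega> s = \<sigma> s + (\<omega> * h s) *\<^sub>R (0, w)" for \<omega> s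
  have h1: "h s = - (\<kappa> * a) + \<kappa> * s" if "s \<in> {a..m}" for s
    using that by (simp add: h_def \<kappa>_def diff_divide_distrib)
  have h2: "h s = - (\<nu> * b) + \<nu> * s" if "s \<in> {m..b}" for s
    using that assms(1,2) by (cases "s = m") (simp_all add: h_def \<nu>_def divide_simps)
  let ?p = "\<lambda>i::nat. if i = 0 then a else if i = 1 then m else b"
  have part: "partition_of a b 2 ?p"
    using assms(1,2) by (auto simp: partition_of_def less_2_cases_iff)
  have sm: "smooth_on (\<lambda>(\<omega>, s). \<Gamma> \<omega> s) ({-1<..<1} \<times> {?p i..?p (Suc i)})" if i: "i < 2" for i
  proof -
    consider "i = 0" | "i = 1" using i by linarith
    then show ?thesis
    proof cases
      case 1
      with smooth_on_affine_variation[OF assms(3) h1, of "(0, w)" "{-1<..<1}"] show ?thesis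
        by (simp add: \<Gamma>_def[abs_def] del: scaleR_Pair)
    next
      case 2
      with smooth_on_affine_variation[OF assms(4) h2, of "(0, w)" "{-1<..<1}"] show ?thesis
        by (simp add: \<Gamma>_def[abs_def] del: scaleR_Pair)
    qed
  qed
  have "fixed_endpoint_variation a b \<sigma> \<Gamma>"
    unfolding fixed_endpoint_variation_def
  proof (intro exI[of _ "1::real"] exI[of _ "2::nat"] exI[of _ ?p] conjI)
    show "\<forall>\<omega>\<in>{- 1<..<1}. \<Gamma> \<omega> a = \<sigma> a \<and> \<Gamma> \<omega> b = \<sigma> b"
      using assms(1,2) by (simp add: \<Gamma>_def h_def zero_prod_def)
    show "\<forall>i<2. smooth_on (\<lambda>(\<omega>, s). \<Gamma> \<omega> s) ({-1<..<1} \<times> {?p i..?p (Suc i)})"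
      by (intro allI impI sm)
  qed (simp_all add: part \<Gamma>_def zero_prod_def[symmetric])
  then have D0: "((\<lambda>\<omega>. action (lorentz_finsler F) a b (\<Gamma> \<omega>)) has_real_derivative 0) (at 0)"
    using crit unfolding critical_curve_def by blast
  let ?A = "\<lambda>\<omega>. integral {a..m} (\<lambda>s. (fst (c s))\<^sup>2 - energy F (fst (\<sigma> s)) (snd (c s) + (\<omega> * \<kappa>) *\<^sub>R w))"
  let ?B = "\<lambda>\<omega>. integral {m..b} (\<lambda>s. (fst (d s))\<^sup>2 - energy F (fst (\<sigma> s)) (snd (d s) + (\<omega> * \<nu>) *\<^sub>R w))"
  have act: "action (lorentz_finsler F) a b (\<Gamma> \<omega>) = ?A \<omega> + ?B \<omega>" for \<omega>
  proof -
    have "((\<lambda>s. lorentz_finsler F (\<Gamma> \<omega> s) (vector_derivative (\<Gamma> \<omega>) (at s))) has_integral ?A \<omega>) {a..m}"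
      using c(1,2) h1 by (rule affine_variation_action) (simp_all add: \<Gamma>_def[abs_def])
    moreover have "((\<lambda>s. lorentz_finsler F (\<Gamma> \<omega> s) (vector_derivative (\<Gamma> \<omega>) (at s))) has_integral ?B \<omega>) {m..b}"
      using d(1,2) h2 by (rule affine_variation_action) (simp_all add: \<Gamma>_def[abs_def])
    ultimately have "((\<lambda>s. lorentz_finsler F (\<Gamma> \<omega> s) (vector_derivative (\<Gamma> \<omega>) (at s))) has_integral
        ?A \<omega> + ?B \<omega>) {a..b}"
      using assms(1,2) by (intro has_integral_combine[of a m b]) simp_all
    then show ?thesis unfolding action_def by (rule integral_unique)
  qed
  let ?P = "integral {a..m} (\<lambda>s. momentum F (fst (\<sigma> s)) (snd (c s)) w)"
  let ?Q = "integral {m..b} (\<lambda>s. momentum F (fst (\<sigma> s)) (snd (d s)) w)"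
  have "(?A has_real_derivative - \<kappa> * ?P) (at 0)"
    by (intro action_piece_derivative continuous_on_fst continuous_on_snd c(2,3)
        continuous_on_vector_derivative[OF c(1)])
  moreover have "(?B has_real_derivative - \<nu> * ?Q) (at 0)"
    by (intro action_piece_derivative continuous_on_fst continuous_on_snd d(2,3)
        continuous_on_vector_derivative[OF d(1)])
  ultimately have "((\<lambda>\<omega>. ?A \<omega> + ?B \<omega>) has_real_derivative - \<kappa> * ?P + - \<nu> * ?Q) (at 0)"
    by (rule DERIV_add)
  \<comment> \<open>Since the slopes are the reciprocals of the two lengths up to sign, vanishing of
    the first variation is equality of the two means.\<close>
  then have "- \<kappa> * ?P + - \<nu> * ?Q = 0"
    using D0 DERIV_unique unfolding act by blast
  then show ?thesis
    by (simp add: \<kappa>_def \<nu>_def)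
qed

text \<open>Equal means on both sides of every split point \<open>m\<close> make the integral of the
  momentum from \<open>a\<close> to \<open>m\<close> linear in \<open>m\<close>, so its derivative,
  the momentum, is constant. As in the argument of du Bois-Reymond, no second derivative of the
  curve is taken.\<close>

lemma momentum_constant_on_piece:
  fixes \<sigma> :: "real \<Rightarrow> real \<times> 'a"
  assumes "a < b" "smooth_on \<sigma> {a..b}"
    and c: "\<And>s. s \<in> {a..b} \<Longrightarrow> (\<sigma> has_vector_derivative c s) (at s within {a..b})"
      "continuous_on {a..b} c" "\<And>s. s \<in> {a..b} \<Longrightarrow> snd (c s) \<noteq> 0"
    and crit: "critical_curve (lorentz_finsler F) a b \<sigma>"
    and s: "s \<in> {a..b}"
  shows "momentum F (fst (\<sigma> s)) (snd (c s)) w = momentum F (fst (\<sigma> a)) (snd (c a)) w"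
proof -
  let ?P = "\<lambda>s. momentum F (fst (\<sigma> s)) (snd (c s)) w"
  have cP: "continuous_on {a..b} ?P"
    by (intro continuous_on_momentum_compose continuous_on_fst continuous_on_snd c(2,3)
        continuous_on_vector_derivative[OF c(1)])
  define \<kappa> where "\<kappa> = integral {a..b} ?P / (b - a)"
  \<comment> \<open>Equal quotients agree with their mediant.\<close>
  have mean: "X = (X + Y) / (u + v) * u" if "X / u = Y / v" "0 < u" "0 < v" for X Y u v :: real
  proof -
    have "X * v = Y * u" using that by (simp add: field_simps)
    then have "X * (u + v) = (X + Y) * u" by (simp add: algebra_simps)
    then show ?thesis using that(2,3) by (simp add: field_simps)
  qed
  have aff: "integral {a..m} ?P = \<kappa> * (m - a)" if m: "m \<in> {a..b}" for m
  proof -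
    consider "m = a" | "m = b" | "a < m" "m < b" using m by fastforce
    then show ?thesis
    proof cases
      case 3
      have cd: "(\<sigma> has_vector_derivative c s) (at s within S)" if "s \<in> S" "S \<subseteq> {a..b}" for s S
        by (rule has_vector_derivative_within_subset[OF c(1)]) (use that in auto)
      have "integral {a..m} ?P / (m - a) = integral {m..b} ?P / (b - m)"
        by (rule critical_curve_mean_momentum[where \<sigma> = \<sigma>])
          (use 3 c(3) in \<open>auto intro!: cd crit smooth_on_subset[OF assms(2)] continuous_on_subset[OF c(2)]\<close>)
      then have "integral {a..m} ?P =
          (integral {a..m} ?P + integral {m..b} ?P) / ((m - a) + (b - m)) * (m - a)"
        by (rule mean) (use 3 in simp_all)
      moreover have "integral {a..m} ?P + integral {m..b} ?P = integral {a..b} ?P"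
        using 3 by (intro Henstock_Kurzweil_Integration.integral_combine integrable_continuous_real cP) auto
      moreover have "(m - a) + (b - m) = b - a" by simp
      ultimately show ?thesis unfolding \<kappa>_def by (simp only:)
    qed (use assms(1) in \<open>simp_all add: \<kappa>_def\<close>)
  qed
  have P: "?P m = \<kappa>" if m: "m \<in> {a..b}" for m
  proof -
    have "((\<lambda>m. integral {a..m} ?P) has_vector_derivative ?P m) (at m within {a..b})"
      by (rule integral_has_vector_derivative[OF cP m])
    moreover have "((\<lambda>m. integral {a..m} ?P) has_vector_derivative \<kappa>) (at m within {a..b})"
    proof (rule has_vector_derivative_transform[OF m])
      show "((\<lambda>m. \<kappa> * (m - a)) has_vector_derivative \<kappa>) (at m within {a..b})"
        by (auto intro!: derivative_eq_intros)
    qed (rule aff)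
    ultimately show ?thesis
      using vector_derivative_unique_within_closed_interval[OF assms(1)] m by simp
  qed
  show ?thesis using P[OF s] P[of a] assms(1) by simp
qed

text \<open>At a break, a tent over the two adjacent pieces compares their means, and these are the
  constant values on the pieces: the Weierstrass-Erdmann corner condition. A priori the velocities
  on the two sides of a break differ, hence the index in \<open>c i s\<close>.\<close>

lemma momentum_conserved:
  fixes \<sigma> :: "real \<Rightarrow> real \<times> 'a"
  assumes p: "partition_of a b n p" and sm: "\<And>i. i < n \<Longrightarrow> smooth_on \<sigma> {p i..p (Suc i)}"
    and c: "\<And>i s. i < n \<Longrightarrow> s \<in> {p i..p (Suc i)} \<Longrightarrow>
        (\<sigma> has_vector_derivative c i s) (at s within {p i..p (Suc i)})"
      "\<And>i. i < n \<Longrightarrow> continuous_on {p i..p (Suc i)} (c i)"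
      "\<And>i s. i < n \<Longrightarrow> s \<in> {p i..p (Suc i)} \<Longrightarrow> snd (c i s) \<noteq> 0"
    and crit: "\<And>r s. a \<le> r \<Longrightarrow> r < s \<Longrightarrow> s \<le> b \<Longrightarrow> critical_curve (lorentz_finsler F) r s \<sigma>"
    and i: "i < n" "s \<in> {p i..p (Suc i)}"
  shows "momentum F (fst (\<sigma> s)) (snd (c i s)) w = momentum F (fst (\<sigma> a)) (snd (c 0 a)) w"
proof -
  let ?P = "\<lambda>i s. momentum F (fst (\<sigma> s)) (snd (c i s)) w"
  have piece: "?P i s = ?P i (p i)" if "i < n" "s \<in> {p i..p (Suc i)}" for i s
    using momentum_constant_on_piece[OF partition_of_step[OF p that(1)] sm[OF that(1)]
        c[OF that(1)] crit that(2)] partition_of_bounds[OF p] partition_of_step[OF p that(1)] that(1)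
    by simp
  have mean: "integral {p i..p (Suc i)} (?P i) = ?P i (p i) * (p (Suc i) - p i)" if "i < n" for i
  proof -
    have "integral {p i..p (Suc i)} (?P i) = integral {p i..p (Suc i)} (\<lambda>_. ?P i (p i))"
      by (rule integral_cong) (rule piece[OF that])
    then show ?thesis using partition_of_step[OF p that] by simp
  qed
  have "?P i (p i) = ?P 0 (p 0)" if "i < n" for i
    using that
  proof (induction i)
    case (Suc i)
    then have "i < n" by simp
    have "integral {p i..p (Suc i)} (?P i) / (p (Suc i) - p i)
        = integral {p (Suc i)..p (Suc (Suc i))} (?P (Suc i)) / (p (Suc (Suc i)) - p (Suc i))"
    proof (rule critical_curve_mean_momentum[OF _ _ sm[OF \<open>i < n\<close>] sm[OF Suc.prems]
          c[OF \<open>i < n\<close>] c[OF Suc.prems]])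
      show "critical_curve (lorentz_finsler F) (p i) (p (Suc (Suc i))) \<sigma>"
      proof (rule crit)
        show "a \<le> p i" "p (Suc (Suc i)) \<le> b"
          using partition_of_bounds[OF p] Suc.prems by simp_all
        show "p i < p (Suc (Suc i))"
          using partition_of_step[OF p \<open>i < n\<close>] partition_of_step[OF p Suc.prems] by simp
      qed
    qed (use partition_of_step[OF p] Suc.prems \<open>i < n\<close> in simp_all)
    then have "?P i (p i) = ?P (Suc i) (p (Suc i))"
      using mean[OF \<open>i < n\<close>] mean[OF Suc.prems] partition_of_step[OF p \<open>i < n\<close>]
        partition_of_step[OF p Suc.prems] by simp
    then show ?case using Suc.IH[OF \<open>i < n\<close>] by simp
  qed simp
  from trans[OF piece[OF i] this[OF i(1)]] show ?thesis
    using p by (simp only: partition_of_def)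
qed

end

section \<open>Supporting hyperplanes of convex hypersurfaces\<close>

text \<open>A velocity is a limit of secants divided by \<open>s\<close>. The limit is taken from
  the right, since a cone absorbs only nonnegative factors.\<close>

lemma tangent_space_subset_closure_cone:
  assumes "u \<in> tangent_space S x"
  shows "u \<in> closure (cone hull ((\<lambda>y. y - x) ` S))"
proof -
  let ?C = "cone hull ((\<lambda>y. y - x) ` S)"
  obtain \<epsilon> c where c: "0 < \<epsilon>" "c ` {-\<epsilon><..<\<epsilon>} \<subseteq> S" "c 0 = x" "(c has_vector_derivative u) (at 0)"
    using assms unfolding tangent_space_def by blast
  have "((\<lambda>s. norm (c s - x - s *\<^sub>R u) / norm s) \<longlongrightarrow> 0) (at 0)"
    using c(3,4) by (simp add: has_vector_derivative_def has_derivative_at)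
  moreover have "\<forall>\<^sub>F s in at 0. norm (c s - x - s *\<^sub>R u) / norm s = norm ((c s - x) /\<^sub>R s - u)"
    unfolding eventually_at_filter
  proof (intro always_eventually allI impI)
    fix s :: real assume "s \<noteq> 0"
    then have "(c s - x) /\<^sub>R s - u = (c s - x - s *\<^sub>R u) /\<^sub>R s"
      by (simp add: scaleR_right_diff_distrib)
    then show "norm (c s - x - s *\<^sub>R u) / norm s = norm ((c s - x) /\<^sub>R s - u)"
      by (simp add: divide_inverse mult.commute)
  qed
  ultimately have "((\<lambda>s. norm ((c s - x) /\<^sub>R s - u)) \<longlongrightarrow> 0) (at 0)"
    by (rule Lim_transform_eventually)
  then have "((\<lambda>s. (c s - x) /\<^sub>R s) \<longlongrightarrow> u) (at 0)"
    by (rule LIM_zero_cancel[OF tendsto_norm_zero_cancel])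
  then have "((\<lambda>s. (c s - x) /\<^sub>R s) \<longlongrightarrow> u) (at_right 0)"
    by (rule tendsto_mono[rotated]) (simp add: at_le)
  moreover have "\<forall>\<^sub>F s in at_right 0. (c s - x) /\<^sub>R s \<in> closure ?C"
    using eventually_at_right_real[OF c(1)]
  proof eventually_elim
    case (elim s)
    then have "c s - x \<in> ?C" using c(1,2) by (intro hull_inc imageI) (auto simp: image_subset_iff)
    then have "(c s - x) /\<^sub>R s \<in> ?C"
      using cone_cone_hull[of "(\<lambda>y. y - x) ` S"] elim unfolding cone_def by simp
    then show ?case using closure_subset by blast
  qed
  ultimately show ?thesis
    by (intro Lim_in_closed_set[of "closure ?C" "\<lambda>s. (c s - x) /\<^sub>R s" "at_right 0"]) simp_all
qed

text \<open>The image of the model subspace under the derivative of the inverse chart.\<close>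

lemma embedded_submanifold_tangent_subspace:
  fixes S :: "'a::euclidean_space set"
  assumes "embedded_submanifold k S" "p \<in> S"
  obtains W where "subspace W" "dim W = k" "W \<subseteq> tangent_space S p"
proof -
  obtain U V :: "'a set" and \<phi> \<psi> L where chart: "open U" "p \<in> U" "open V" "homeomorphism U V \<phi> \<psi>"
      "smooth_on \<phi> U" "smooth_on \<psi> V" "subspace L" "dim L = k" "\<phi> ` (S \<inter> U) = L \<inter> V"
    using assms(1)[unfolded embedded_submanifold_def, rule_format, OF assms(2)]
    by (elim exE conjE) (rule that; assumption)
  define q where "q = \<phi> p"
  have "q \<in> \<phi> ` (S \<inter> U)" unfolding q_def using assms(2) chart(2) by (intro imageI) simp
  then have q: "q \<in> L" "q \<in> V" unfolding chart(9) by simp_all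
  have q': "\<psi> q = p" unfolding q_def by (rule homeomorphism_apply1[OF chart(4,2)])
  define D where "D = frechet_derivative \<psi> (at q)"
  have D: "(\<psi> has_derivative D) (at q)"
    unfolding D_def by (rule Ck_on_2_derivative(1)[OF smooth_on_openD[OF chart(6,3)] q(2)])
  have E: "(\<phi> has_derivative frechet_derivative \<phi> (at p)) (at (\<psi> q))"
    unfolding q' by (rule Ck_on_2_derivative(1)[OF smooth_on_openD[OF chart(5,1)] chart(2)])
  have inv: "\<phi> (\<psi> y) = y" if "y \<in> V" for y
    using chart(4) that by (simp add: homeomorphism_def)
  have "((\<lambda>y. \<phi> (\<psi> y)) has_derivative (\<lambda>w. frechet_derivative \<phi> (at p) (D w))) (at q)"
    by (rule has_derivative_compose[OF D E])
  moreover have "((\<lambda>y. \<phi> (\<psi> y)) has_derivative (\<lambda>w. w)) (at q)"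
    by (rule has_derivative_transform_within_open[OF has_derivative_ident chart(3) q(2)])
      (simp add: inv)
  \<comment> \<open>The derivative of the chart is a left inverse of \<open>D\<close>, so the image
    of \<open>L\<close> keeps its dimension.\<close>
  ultimately have ED: "(\<lambda>w. frechet_derivative \<phi> (at p) (D w)) = (\<lambda>w. w)"
    by (rule has_derivative_unique)
  have "inj D" by (rule inj_on_inverseI[of _ "frechet_derivative \<phi> (at p)"]) (rule fun_cong[OF ED])
  have lin: "linear D" by (rule has_derivative_linear[OF D])
  have "D w \<in> tangent_space S p" if w: "w \<in> L" for w
  proof -
    let ?V = "(\<lambda>s::real. q + s *\<^sub>R w) -` V"
    have "open ?V"
      by (intro open_vimage chart(3) continuous_intros)
    moreover have "0 \<in> ?V" using q(2) by simp
    ultimately obtain \<epsilon> where e: "0 < \<epsilon>" "ball 0 \<epsilon> \<subseteq> ?V"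
      using open_contains_ball by blast
    have sub: "{-\<epsilon><..<\<epsilon>} \<subseteq> ?V"
      using e(2) by (simp add: ball_eq_greaterThanLessThan)
    let ?c = "\<lambda>s. \<psi> (q + s *\<^sub>R w)"
    have "Ck_on k ?c ?V" for k
      by (rule Ck_on_compose_affine[OF chart(3) bounded_linear_scaleR_left
            smooth_on_openD[OF chart(6,3)]])
    then have "smooth_on ?c {-\<epsilon><..<\<epsilon>}"
      unfolding smooth_on_def using \<open>open ?V\<close> sub by blast
    moreover have "?c ` {-\<epsilon><..<\<epsilon>} \<subseteq> S"
    proof
      fix x assume "x \<in> ?c ` {-\<epsilon><..<\<epsilon>}"
      then obtain s where s: "x = \<psi> (q + s *\<^sub>R w)" "q + s *\<^sub>R w \<in> V" using sub by blast
      moreover have "q + s *\<^sub>R w \<in> L"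
        using chart(7) q(1) w by (intro subspace_add subspace_scale)
      ultimately have "q + s *\<^sub>R w \<in> \<phi> ` (S \<inter> U)" unfolding chart(9) by simp
      then obtain y where y: "q + s *\<^sub>R w = \<phi> y" "y \<in> S \<inter> U" by (rule imageE)
      then show "x \<in> S" using s homeomorphism_apply1[OF chart(4), of y] by simp
    qed
    moreover have "(?c has_vector_derivative D w) (at 0)"
    proof -
      have "((\<lambda>s. q + s *\<^sub>R w) has_derivative (\<lambda>s. s *\<^sub>R w)) (at 0)"
        by (auto intro!: derivative_eq_intros)
      moreover have "(\<psi> has_derivative D) (at (q + 0 *\<^sub>R w))" using D by simp
      ultimately have "(?c has_derivative (\<lambda>s. D (s *\<^sub>R w))) (at 0)"
        by (rule has_derivative_compose)
      then show ?thesis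
        by (simp add: has_vector_derivative_def linear_scale[OF lin])
    qed
    moreover have "?c 0 = p" using q' by simp
    ultimately show ?thesis
      unfolding tangent_space_def using e(1) by blast
  qed
  moreover have "subspace (D ` L)" by (rule linear_subspace_image[OF lin chart(7)])
  moreover have "dim (D ` L) = k"
    using dim_image_eq[OF lin] \<open>inj D\<close> chart(8) by (simp add: inj_on_subset)
  ultimately show ?thesis using that by blast
qed

text \<open>Were \<open>a\<close> strictly beyond the hyperplane through \<open>z\<close>, the
  closed cone of the convex region at \<open>z\<close> would contain the kernel of \<open>l\<close>,
  spanned by tangent vectors, together with \<open>a - z\<close>, hence the whole open half-space
  where \<open>l\<close> is positive. Then \<open>v\<close> would point from \<open>z\<close> into
  the region, against outwardness.\<close>

lemma convex_hypersurface_supporting: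
  fixes A :: "'a::euclidean_space set"
  assumes "embedded_submanifold (DIM('a) - 1) A" "convex_hypersurface A" "points_outward A z v"
    and l: "linear l" "\<And>u. u \<in> tangent_space A z \<Longrightarrow> l u = 0" "0 < l v"
    and "z \<in> A" "a \<in> A"
  shows "l a \<le> (l z :: real)"
proof (rule ccontr)
  assume "\<not> l a \<le> l z"
  then have az: "0 < l (a - z)" using l(1) by (simp add: linear_diff)
  define K where "K = A \<union> inside A"
  define C where "C = cone hull ((\<lambda>x. x - z) ` K)"
  have "convex K" using assms(2) by (simp add: K_def convex_hypersurface_def)
  then have "convex C" unfolding C_def by (intro convex_cone_hull convex_translation_subtract)
  then have cc: "convex (closure C)" "cone (closure C)"
    unfolding C_def by (auto intro: convex_closure cone_closure cone_cone_hull)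
  then have add: "x + y \<in> closure C" if "x \<in> closure C" "y \<in> closure C" for x y
    using convex_cone[of "closure C"] that by blast
  have scale: "r *\<^sub>R x \<in> closure C" if "x \<in> closure C" "0 \<le> r" for x r
    using cc(2) that by (simp add: cone_def)
  obtain W where W: "subspace W" "dim W = DIM('a) - 1" "W \<subseteq> tangent_space A z"
    using embedded_submanifold_tangent_subspace[OF assms(1) \<open>z \<in> A\<close>] .
  have "tangent_space A z \<subseteq> closure C"
  proof
    fix u assume "u \<in> tangent_space A z"
    then have "u \<in> closure (cone hull ((\<lambda>x. x - z) ` A))"
      by (rule tangent_space_subset_closure_cone)
    also have "\<dots> \<subseteq> closure C"
      unfolding C_def K_def by (intro closure_mono hull_mono image_mono) simp
    finally show "u \<in> closure C" .
  qed
  then have WC: "W \<subseteq> closure C" using W(3) by blast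
  \<comment> \<open>The vector that represents \<open>l\<close> as an inner product.\<close>
  define e where "e = adjoint l 1"
  have le: "l x = e \<bullet> x" for x
    using adjoint_works[OF l(1), of x 1] by (simp add: e_def inner_commute)
  have "e \<noteq> 0" using l(3) by (auto simp: le)
  \<comment> \<open>Codimension one is decisive: the tangent vectors fill the entire kernel.\<close>
  have ker: "W = {x. e \<bullet> x = 0}"
  proof (rule subspace_dim_equal[OF W(1) subspace_hyperplane])
    show "W \<subseteq> {x. e \<bullet> x = 0}" using W(3) l(2) le by auto
    show "dim {x. e \<bullet> x = 0} \<le> dim W" using dim_hyperplane[OF \<open>e \<noteq> 0\<close>] W(2) by simp
  qed
  have "{x. e \<bullet> x > 0} \<subseteq> closure C"
  proof
    fix x assume x: "x \<in> {x. e \<bullet> x > 0}"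
    \<comment> \<open>Chosen so that subtracting \<open>r *\<^sub>R (a - z)\<close> from
      \<open>x\<close> lands in the kernel; it is nonnegative because \<open>l\<close> is positive
      on \<open>x\<close> and on \<open>a - z\<close>.\<close>
    define r where "r = (e \<bullet> x) / (e \<bullet> (a - z))"
    have "x - r *\<^sub>R (a - z) \<in> W"
      using az by (simp add: ker r_def le inner_diff_right)
    moreover have "a - z \<in> closure C"
      unfolding C_def K_def using \<open>a \<in> A\<close> by (intro subsetD[OF closure_subset] hull_inc imageI) simp
    then have "r *\<^sub>R (a - z) \<in> closure C"
      by (rule scale) (use x az in \<open>simp add: r_def le\<close>)
    ultimately have "(x - r *\<^sub>R (a - z)) + r *\<^sub>R (a - z) \<in> closure C"
      using WC by (intro add) auto
    then show "x \<in> closure C" by simp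
  qed
  then have "{x. e \<bullet> x > 0} \<subseteq> interior (closure C)"
    by (rule interior_maximal) (rule open_halfspace_gt)
  \<comment> \<open>A convex set and its closure have the same interior, so \<open>v\<close> lies in
    the cone itself and thus points to an actual point \<open>k\<close> of the region.\<close>
  also have "\<dots> = interior C" by (rule convex_interior_closure[OF \<open>convex C\<close>])
  finally have "v \<in> C" using l(3) interior_subset by (auto simp: le)
  moreover have "v \<noteq> 0" using l(3) by (auto simp: le)
  ultimately obtain r k where k: "0 < r" "k \<in> K" "v = r *\<^sub>R (k - z)"
    unfolding C_def cone_hull_expl by (force simp: less_le)
  obtain \<epsilon> where eps: "0 < \<epsilon>" "\<And>s. s \<in> {0<..<\<epsilon>} \<Longrightarrow> z + s *\<^sub>R v \<in> outside A"
    using assms(3) unfolding points_outward_def by blast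
  \<comment> \<open>Below \<open>\<epsilon>\<close>, so that the point is outside \<open>A\<close>;
    at most \<open>1 / r\<close>, so that it lies on the segment from \<open>z\<close> to
    \<open>k\<close>.\<close>
  define s where "s = min (\<epsilon> / 2) (1 / r)"
  have s: "0 < s" "s < \<epsilon>" "s * r \<le> 1"
    using eps(1) k(1) by (auto simp: s_def min_def field_simps)
  have "(1 - s * r) *\<^sub>R z + (s * r) *\<^sub>R k \<in> K"
    using \<open>convex K\<close> k s \<open>z \<in> A\<close> by (intro convexD) (auto simp: K_def)
  also have "(1 - s * r) *\<^sub>R z + (s * r) *\<^sub>R k = z + s *\<^sub>R v"
    by (simp add: k(3) algebra_simps)
  finally show False
    using eps(2)[of s] s disjoint_iff[THEN iffD1, OF outside_no_overlap[of A]]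
      disjoint_iff[THEN iffD1, OF inside_Int_outside[of A]]
    by (auto simp: K_def)
qed

section \<open>Calibration of the trajectories\<close>

context time_only_finsler
begin

lemma momentum_le:
  assumes "energy F t v = 1" "energy F t u \<le> 1"
  shows "momentum F t v u \<le> 2"
proof (cases "u = v")
  case True
  moreover have "v \<noteq> 0" using assms(1) energy_zero by force
  ultimately show ?thesis using momentum_self assms(1) by simp
next
  case False
  then show ?thesis using momentum_less[OF assms] by simp
qed

section \<open>Causal and lightlike curves parametrized by time\<close>

lemma graph_right_derivative:
  assumes "((\<lambda>t. (t, g t)) has_vector_derivative w) (at_right t)"
  shows "fst w = 1" and "(g has_vector_derivative snd w) (at_right t)"
proof -
  have "((\<lambda>t. fst (t, g t)) has_vector_derivative fst w) (at_right t)"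
    by (rule bounded_linear.has_vector_derivative[OF bounded_linear_fst assms])
  then have "((\<lambda>t. t) has_vector_derivative fst w) (at_right t)" by simp
  moreover have "((\<lambda>t. t) has_vector_derivative 1) (at_right t)"
    by (rule has_vector_derivative_id[unfolded id_def])
  ultimately show "fst w = 1" by (rule has_vector_derivative_right_unique)
  have "((\<lambda>t. snd (t, g t)) has_vector_derivative snd w) (at_right t)"
    by (rule bounded_linear.has_vector_derivative[OF bounded_linear_snd assms])
  then show "(g has_vector_derivative snd w) (at_right t)" by simp
qed

lemma causal_on_right_derivative:
  assumes "causal_on F I (\<lambda>t. (t, g t))" "t < r" "{t..r} \<subseteq> I"
  shows "\<exists>u. (g has_vector_derivative u) (at_right t) \<and> energy F t u \<le> 1"
proof -
  have "piecewise_smooth_on I (\<lambda>t. (t, g t))"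
    using assms(1) by (simp add: causal_on_def regular_curve_on_def)
  then obtain w where w: "((\<lambda>t. (t, g t)) has_vector_derivative w) (at_right t)"
    using piecewise_smooth_on_right_derivative[OF _ assms(2,3)] by blast
  have "t \<in> I" "r \<in> I" using assms(2,3) by (simp_all add: subset_iff)
  then have "0 \<le> lorentz_finsler F (t, g t) w"
    using velocities_right[OF w _ assms(2)] assms(1) unfolding causal_on_def by blast
  then have "energy F t (snd w) \<le> 1"
    using graph_right_derivative(1)[OF w]
    by (simp add: lorentz_finsler_def case_prod_unfold energy_eq)
  then show ?thesis using graph_right_derivative(2)[OF w] by blast
qed

lemma causal_on_continuous:
  assumes "causal_on F I (\<lambda>t. (t, g t))" "a < b" "{a..b} \<subseteq> I"
  shows "continuous_on {a..b} g"
proof -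
  have "piecewise_smooth_on I (\<lambda>t. (t, g t))"
    using assms(1) by (simp add: causal_on_def regular_curve_on_def)
  then have "continuous_on {a..b} (\<lambda>t. (t, g t))"
    by (rule piecewise_smooth_on_continuous) fact+
  from continuous_on_snd[OF this] show ?thesis by simp
qed

lemma lightlike_on_imp_causal_on: "lightlike_on F I c \<Longrightarrow> causal_on F I c"
  unfolding lightlike_on_def causal_on_def by auto

lemma lightlike_velocity:
  assumes "lightlike_on F I c" "t \<in> I" "u \<in> velocities I c t"
  shows "energy F (fst (c t)) (snd u) = (fst u)\<^sup>2"
proof -
  have "lorentz_finsler F (c t) u = 0"
    using assms unfolding lightlike_on_def by blast
  then show ?thesis
    by (simp add: lorentz_finsler_def case_prod_unfold energy_eq)
qed

lemma energy_lightlike_reparametrized: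
  assumes "lightlike_on F I c" "t \<in> I" "u \<in> velocities I c t" "w = \<tau> *\<^sub>R u" "0 < \<tau>"
  shows "energy F (fst (c t)) (snd w) = (fst w)\<^sup>2"
  using lightlike_velocity[OF assms(1-3)] assms(4,5) by (simp add: energy_scale power_mult_distrib)

text \<open>Each one-sided velocity of the reparametrized graph is a velocity of the graph times a
  positive derivative of \<open>\<theta>\<close>, and homogeneity of the energy preserves the
  lightlike condition. It follows that the spatial velocity is nonzero, so the momentum can be used
  along the geodesic parametrization.\<close>

lemma pregeodesic_velocity:
  assumes light: "lightlike_on F {0..} (\<lambda>t. (t, g t))"
    and J: "is_interval J" "\<theta> ` J = {0..}" "strict_mono_on J \<theta>"
    and pos: "\<forall>s\<in>J. \<forall>w\<in>velocities J \<theta> s. 0 < w"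
    and s: "s \<in> J" and w: "w \<in> velocities J ((\<lambda>t. (t, g t)) \<circ> \<theta>) s"
  shows "0 < fst w" and "energy F (\<theta> s) (snd w) = (fst w)\<^sup>2"
proof -
  let ?c = "\<lambda>t. (t, g t)"
  have ps: "piecewise_smooth_on {0..} ?c"
    using light by (simp add: lightlike_on_def regular_curve_on_def)
  have nonneg: "0 \<le> \<theta> r" if "r \<in> J" for r using J(2) that by auto
  \<comment> \<open>The time component of the reparametrized graph is \<open>\<theta>\<close>
    itself.\<close>
  have th: "(\<theta> has_vector_derivative fst w) G" if "((?c \<circ> \<theta>) has_vector_derivative w) G" for G
    using bounded_linear.has_vector_derivative[OF bounded_linear_fst that] by (simp add: o_def)
  have "0 < fst w \<and> (\<exists>u\<in>velocities {0..} ?c (\<theta> s). w = fst w *\<^sub>R u)"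
    using w[unfolded velocities_def]
  proof (elim CollectE disjE conjE bexE)
    fix r assume r: "r \<in> J" "s < r" and D: "((?c \<circ> \<theta>) has_vector_derivative w) (at_right s)"
    have "fst w \<in> velocities J \<theta> s" by (rule velocities_right[OF th[OF D] r])
    then have "0 < fst w" using pos s by blast
    have sub: "{\<theta> s..\<theta> s + 1} \<subseteq> {0..}" using nonneg[OF s] by auto
    obtain u where u: "(?c has_vector_derivative u) (at_right (\<theta> s))"
      using piecewise_smooth_on_right_derivative[OF ps _ sub] by auto
    have "\<theta> s \<le> \<theta> y" if y: "s \<le> y" "y \<le> r" for y
    proof -
      have "y \<in> J" using J(1) s r(1) y unfolding is_interval_1 by blast
      then show ?thesis using J(3) s y(1) by (simp add: strict_mono_on_leD)
    qed
    then have "((?c \<circ> \<theta>) has_vector_derivative fst w *\<^sub>R u) (at_right s)"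
      by (rule right_derivative_compose[OF th[OF D] u r(2)])
    from has_vector_derivative_right_unique[OF D this] have "w = fst w *\<^sub>R u" .
    moreover have "u \<in> velocities {0..} ?c (\<theta> s)"
      by (rule velocities_right[OF u, of "\<theta> s + 1"]) (use nonneg[OF s] in auto)
    ultimately show ?thesis using \<open>0 < fst w\<close> by blast
  next
    fix r assume r: "r \<in> J" "r < s" and D: "((?c \<circ> \<theta>) has_vector_derivative w) (at_left s)"
    have "fst w \<in> velocities J \<theta> s"
      unfolding velocities_def using th[OF D] r by blast
    then have "0 < fst w" using pos s by blast
    have lt: "\<theta> r < \<theta> s" using J(3) r s by (simp add: strict_mono_onD)
    have sub: "{\<theta> r..\<theta> s} \<subseteq> {0..}" using nonneg[OF r(1)] by auto
    obtain u where u: "(?c has_vector_derivative u) (at_left (\<theta> s))"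
      using piecewise_smooth_on_left_derivative[OF ps lt sub] by auto
    have "\<theta> y \<le> \<theta> s" if y: "r \<le> y" "y \<le> s" for y
    proof -
      have "y \<in> J" using J(1) s r(1) y unfolding is_interval_1 by blast
      then show ?thesis using J(3) s y(2) by (simp add: strict_mono_on_leD)
    qed
    then have "((?c \<circ> \<theta>) has_vector_derivative fst w *\<^sub>R u) (at_left s)"
      by (rule left_derivative_compose[OF th[OF D] u r(2)])
    then have "w = fst w *\<^sub>R u"
      using D by (intro vector_derivative_unique_within[of s "{..<s}" "?c \<circ> \<theta>"]) simp_all
    moreover have "u \<in> velocities {0..} ?c (\<theta> s)"
      unfolding velocities_def using u lt nonneg[OF r(1)] by auto
    ultimately show ?thesis using \<open>0 < fst w\<close> by blast
  qed
  then obtain u where "0 < fst w" "u \<in> velocities {0..} ?c (\<theta> s)" "w = fst w *\<^sub>R u"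
    by blast
  then show "0 < fst w" "energy F (\<theta> s) (snd w) = (fst w)\<^sup>2"
    using energy_lightlike_reparametrized[OF light _ _ \<open>w = fst w *\<^sub>R u\<close> \<open>0 < fst w\<close>, of "\<theta> s"]
      nonneg[OF s] by simp_all
qed

text \<open>Along a lightlike pregeodesic the direction of the momentum covector does not change: the
  affine parametrization conserves it, and \<open>\<rho>\<close> accounts for the change of parameter.\<close>

lemma lightlike_pregeodesic_momentum:
  assumes light: "lightlike_on F {0..} (\<lambda>t. (t, g t))"
    and pre: "pregeodesic_on (lorentz_finsler F) {0..} (\<lambda>t. (t, g t))"
    and v: "(g has_vector_derivative v) (at_right 0)"
    and t: "0 \<le> t"
  shows "\<exists>u \<rho>. 0 < \<rho> \<and> (g has_vector_derivative u) (at_right t) \<and> energy F t u = 1 \<and>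
           (\<forall>w. momentum F 0 v w = \<rho> * momentum F t u w)"
proof -
  let ?c = "\<lambda>t. (t, g t)"
  obtain J \<theta> where J: "is_interval J" "\<theta> ` J = {0..}" "piecewise_smooth_on J \<theta>"
      and pos: "\<forall>s\<in>J. \<forall>w\<in>velocities J \<theta> s. 0 < w"
      and geo: "geodesic_on (lorentz_finsler F) J (?c \<circ> \<theta>)"
    using pre unfolding pregeodesic_on_def by blast
  let ?\<sigma> = "?c \<circ> \<theta>"
  have mono: "strict_mono_on J \<theta>"
    by (rule positive_velocities_imp_strict_mono_on[OF J(1,3) pos])
  \<comment> \<open>The time \<open>t + 1\<close> only ensures that there are parameters to the
    right of \<open>s\<close>, for the right derivative there.\<close>
  have "0 \<in> \<theta> ` J" "t \<in> \<theta> ` J" "t + 1 \<in> \<theta> ` J" using J(2) t by auto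
  then obtain a s b where a: "a \<in> J" "\<theta> a = 0" and s: "s \<in> J" "\<theta> s = t"
      and b: "b \<in> J" "\<theta> b = t + 1"
    by (metis imageE)
  have "s < b" using strict_mono_on_less[OF mono s(1) b(1)] s b by simp
  have "a \<le> s" using strict_mono_on_less_eq[OF mono a(1) s(1)] a s t by simp
  have sub: "{a..b} \<subseteq> J"
    using interval_subset_is_interval[OF J(1), of a b] a(1) b(1) by simp
  have ps: "piecewise_smooth_on J ?\<sigma>"
    using geo by (simp add: geodesic_on_def regular_curve_on_def)
  have "a < b" using \<open>s < b\<close> \<open>a \<le> s\<close> by simp
  then obtain n p where p: "partition_of a b n p" "\<And>i. i < n \<Longrightarrow> smooth_on ?\<sigma> {p i..p (Suc i)}"
    using ps sub unfolding piecewise_smooth_on_def by blast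
  \<comment> \<open>Bundles the properties of a derivative on piece \<open>i\<close>, so that one
    choice covers all pieces.\<close>
  define D where "D c' i \<longleftrightarrow> continuous_on {p i..p (Suc i)} c' \<and> (\<forall>s\<in>{p i..p (Suc i)}.
      (?\<sigma> has_vector_derivative c' s) (at s within {p i..p (Suc i)}))" for c' i
  have "\<exists>c'. D c' i" if "i < n" for i
    unfolding D_def by (rule smooth_on_piece_derivative[OF p(2)[OF that]]) blast
  then obtain c where "\<And>i. i < n \<Longrightarrow> D (c i) i" by metis
  then have c: "\<And>i s. i < n \<Longrightarrow> s \<in> {p i..p (Suc i)} \<Longrightarrow>
        (?\<sigma> has_vector_derivative c i s) (at s within {p i..p (Suc i)})"
      "\<And>i. i < n \<Longrightarrow> continuous_on {p i..p (Suc i)} (c i)"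
    unfolding D_def by blast+
  have psub: "{p i..p (Suc i)} \<subseteq> J" if "i < n" for i
    using partition_of_bounds[OF p(1), of i] partition_of_bounds[OF p(1), of "Suc i"] that sub
    by (simp add: subset_iff)
  have vel: "0 < fst (c i s)" "energy F (\<theta> s) (snd (c i s)) = (fst (c i s))\<^sup>2"
    if i: "i < n" "s \<in> {p i..p (Suc i)}" for i s
  proof -
    have "c i s \<in> velocities J ?\<sigma> s"
      by (rule velocities_piece[OF c(1)[OF i] partition_of_step[OF p(1) i(1)] i(2) psub[OF i(1)]])
    moreover have "s \<in> J" using psub[OF i(1)] i(2) by blast
    ultimately show "0 < fst (c i s)" "energy F (\<theta> s) (snd (c i s)) = (fst (c i s))\<^sup>2"
      using pregeodesic_velocity[OF light J(1,2) mono pos] by blast+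
  qed
  have nz: "snd (c i s) \<noteq> 0" if "i < n" "s \<in> {p i..p (Suc i)}" for i s
    using vel[OF that] energy_zero by force
  have conserved: "momentum F (\<theta> s) (snd (c i s)) w = momentum F 0 (snd (c 0 a)) w"
    if "i < n" "s \<in> {p i..p (Suc i)}" for i s w
  proof -
    have "critical_curve (lorentz_finsler F) r s ?\<sigma>" if "a \<le> r" "r < s" "s \<le> b" for r s
    proof -
      have "{r..s} \<subseteq> J" using sub that by (auto simp: subset_iff)
      then show ?thesis using geo that(2) unfolding geodesic_on_def by blast
    qed
    from momentum_conserved[OF p c nz this that, of w] show ?thesis using a(2) by simp
  qed
  \<comment> \<open>The velocity in the geodesic parameter factors into the rate of time and a
    velocity of \<open>g\<close> with respect to time.\<close>
  have right: "\<exists>u. (g has_vector_derivative u) (at_right (\<theta> s)) \<and> c i s = fst (c i s) *\<^sub>R (1, u)"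
    if i: "i < n" "p i \<le> s" "s < p (Suc i)" for i s
  proof -
    have s: "s \<in> {p i..p (Suc i)}" using i by simp
    have D: "(?\<sigma> has_vector_derivative c i s) (at_right s)"
      by (rule has_vector_derivative_piece_right[OF c(1)[OF i(1) s] i(2,3)])
    have th: "(\<theta> has_vector_derivative fst (c i s)) (at_right s)"
      using bounded_linear.has_vector_derivative[OF bounded_linear_fst D] by (simp add: o_def)
    have "s \<in> J" using psub[OF i(1)] s by blast
    then have "0 \<le> \<theta> s" using J(2) by auto
    then have "\<exists>w. (?c has_vector_derivative w) (at_right (\<theta> s))"
      using light by (intro piecewise_smooth_on_right_derivative[of "{0..}" _ _ "\<theta> s + 1"])
        (auto simp: lightlike_on_def regular_curve_on_def)
    then obtain w where w: "(?c has_vector_derivative w) (at_right (\<theta> s))" by blast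
    have "\<theta> s \<le> \<theta> y" if "s \<le> y" "y \<le> p (Suc i)" for y
      using psub[OF i(1)] i(2) that \<open>s \<in> J\<close> by (intro strict_mono_on_leD[OF mono]) auto
    then have "(?\<sigma> has_vector_derivative fst (c i s) *\<^sub>R w) (at_right s)"
      by (rule right_derivative_compose[OF th w i(3)])
    from has_vector_derivative_right_unique[OF D this] have "c i s = fst (c i s) *\<^sub>R w" .
    moreover have "w = (1, snd w)"
      using graph_right_derivative(1)[OF w] by (simp add: prod_eq_iff)
    ultimately show ?thesis using graph_right_derivative(2)[OF w] by metis
  qed
  have "0 < n" by (rule partition_of_pos[OF p(1) \<open>a < b\<close>])
  then have pa: "p 0 = a" "a < p (Suc 0)"
    using p(1) partition_of_step[OF p(1), of 0] by (simp_all add: partition_of_def)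
  obtain u0 where u0: "(g has_vector_derivative u0) (at_right (\<theta> a))" "c 0 a = fst (c 0 a) *\<^sub>R (1, u0)"
    using right[OF \<open>0 < n\<close>, of a] pa by auto
  then have "u0 = v" using has_vector_derivative_right_unique[OF _ v] a(2) by simp
  define \<tau>\<^sub>0 where "\<tau>\<^sub>0 = fst (c 0 a)"
  have c0: "snd (c 0 a) = \<tau>\<^sub>0 *\<^sub>R v" using arg_cong[OF u0(2), of snd] \<open>u0 = v\<close> by (simp add: \<tau>\<^sub>0_def)
  have a0: "a \<in> {p 0..p (Suc 0)}" using pa by simp
  have "0 < \<tau>\<^sub>0" unfolding \<tau>\<^sub>0_def by (rule vel(1)[OF \<open>0 < n\<close> a0])
  have "v \<noteq> 0" using nz[OF \<open>0 < n\<close> a0] c0 by auto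
  obtain i where i: "i < n" "p i \<le> s" "s < p (Suc i)"
    using partition_of_piece[OF p(1) \<open>a \<le> s\<close> \<open>s < b\<close>] .
  then have si: "s \<in> {p i..p (Suc i)}" by simp
  obtain u where u: "(g has_vector_derivative u) (at_right t)" "c i s = fst (c i s) *\<^sub>R (1, u)"
    using right[OF i] s(2) by auto
  define \<tau> where "\<tau> = fst (c i s)"
  have ci: "snd (c i s) = \<tau> *\<^sub>R u" using arg_cong[OF u(2), of snd] by (simp add: \<tau>_def)
  have "0 < \<tau>" unfolding \<tau>_def by (rule vel(1)[OF i(1) si])
  have "\<tau>\<^sup>2 * energy F t u = \<tau>\<^sup>2"
    using vel(2)[OF i(1) si] energy_scale[OF \<open>0 < \<tau>\<close>] by (simp add: ci \<tau>_def[symmetric] s(2))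
  then have "energy F t u = 1" using \<open>0 < \<tau>\<close> by simp
  have "u \<noteq> 0" using nz[OF i(1) si] ci by auto
  \<comment> \<open>Conservation equates the momenta at \<open>\<tau>\<^sub>0 *\<^sub>R v\<close>
    and \<open>\<tau> *\<^sub>R u\<close>; pulling out the rates of time by homogeneity leaves their
    quotient as \<open>\<rho>\<close>.\<close>
  have "momentum F 0 v w = \<tau> / \<tau>\<^sub>0 * momentum F t u w" for w
    using conserved[OF i(1) si, of w] \<open>0 < \<tau>\<close> \<open>0 < \<tau>\<^sub>0\<close>
    by (simp add: s(2) ci c0 momentum_scale \<open>u \<noteq> 0\<close> \<open>v \<noteq> 0\<close> field_simps)
  moreover have "0 < \<tau> / \<tau>\<^sub>0" using \<open>0 < \<tau>\<close> \<open>0 < \<tau>\<^sub>0\<close> by simp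
  ultimately show ?thesis using u(1) \<open>energy F t u = 1\<close> by blast
qed

text \<open>The initial momentum covector is a calibration: no causal curve increases it faster than the
  trajectory does.\<close>

lemma lightlike_pregeodesic_minimizing:
  assumes light: "lightlike_on F {0..} (\<lambda>t. (t, g t))"
    and pre: "pregeodesic_on (lorentz_finsler F) {0..} (\<lambda>t. (t, g t))"
    and v: "(g has_vector_derivative v) (at_right 0)"
    and caus: "causal_on F {0..t\<^sub>1} (\<lambda>t. (t, \<phi> t))" "0 < t\<^sub>1" "\<phi> t\<^sub>1 = g t\<^sub>0"
    and init: "momentum F 0 v (\<phi> 0) \<le> momentum F 0 v (g 0)"
    and "0 < t\<^sub>0"
  shows "t\<^sub>0 \<le> t\<^sub>1" and "t\<^sub>1 = t\<^sub>0 \<Longrightarrow> t \<in> {0..t\<^sub>0} \<Longrightarrow> \<phi> t = g t"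
proof -
  define P where "P = momentum F 0 v"
  have traj: "\<exists>u \<rho>. 0 < \<rho> \<and> (g has_vector_derivative u) (at_right t) \<and> energy F t u = 1 \<and>
           (\<forall>w. P w = \<rho> * momentum F t u w)" if "0 \<le> t" for t
    unfolding P_def by (rule lightlike_pregeodesic_momentum[OF light pre v that])
  have "energy F 0 v = 1"
    using traj[of 0] has_vector_derivative_right_unique[OF v] by auto
  then have "v \<noteq> 0" using energy_zero by force
  then have lin: "bounded_linear P"
    unfolding P_def by (intro linear_conv_bounded_linear[THEN iffD1] momentum_linear)
  \<comment> \<open>At time \<open>t\<close> the two curves may be at different points; position
    independence still lets the fundamental inequality at \<open>u\<close> be applied to
    \<open>u'\<close>.\<close>
  have deriv: "\<exists>u \<rho> u'. 0 < \<rho> \<and> (g has_vector_derivative u) (at_right t) \<and> energy F t u = 1 \<and>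
      (\<phi> has_vector_derivative u') (at_right t) \<and> energy F t u' \<le> 1 \<and> P u = \<rho> * 2 \<and>
      P u' = \<rho> * momentum F t u u' \<and>
      ((\<lambda>t. P (\<phi> t - g t)) has_vector_derivative \<rho> * (momentum F t u u' - 2)) (at_right t)"
    if t: "0 \<le> t" "t < t\<^sub>1" for t
  proof -
    obtain u \<rho> where u: "0 < \<rho>" "(g has_vector_derivative u) (at_right t)" "energy F t u = 1"
        "\<And>w. P w = \<rho> * momentum F t u w"
      using traj[OF t(1)] by blast
    have "{t..t\<^sub>1} \<subseteq> {0..t\<^sub>1}" using t by simp
    from causal_on_right_derivative[OF caus(1) t(2) this]
    obtain u' where u': "(\<phi> has_vector_derivative u') (at_right t)" "energy F t u' \<le> 1"
      by blast
    have "u \<noteq> 0" using u(3) energy_zero by force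
    then have "P u = \<rho> * 2" using u(3,4) momentum_self by simp
    moreover have "((\<lambda>t. P (\<phi> t - g t)) has_vector_derivative P (u' - u)) (at_right t)"
      by (rule bounded_linear.has_vector_derivative[OF lin has_vector_derivative_diff[OF u'(1) u(2)]])
    moreover have "P (u' - u) = P u' - P u"
      by (rule linear_diff[OF bounded_linear.linear[OF lin]])
    ultimately have "P u = \<rho> * 2"
      "((\<lambda>t. P (\<phi> t - g t)) has_vector_derivative \<rho> * (momentum F t u u' - 2)) (at_right t)"
      by (simp_all add: u(4)[of u'] right_diff_distrib)
    then show ?thesis using u u' by blast
  qed
  have cont_g: "continuous_on {a..b} g" if "0 \<le> a" "a < b" for a b
    by (rule causal_on_continuous[OF lightlike_on_imp_causal_on[OF light]]) (use that in auto)
  have cont: "continuous_on {t..t\<^sub>1} (\<lambda>t. \<phi> t - g t)" if "0 \<le> t" "t < t\<^sub>1" for t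
    by (intro continuous_on_diff causal_on_continuous[OF caus(1)] cont_g) (use that in auto)
  have decr: "P (\<phi> t\<^sub>1 - g t\<^sub>1) \<le> P (\<phi> t - g t)" "P (\<phi> t - g t) \<le> P (\<phi> 0 - g 0)"
    if t: "0 \<le> t" "t \<le> t\<^sub>1" for t
  proof -
    have *: "P (\<phi> s - g s) \<le> P (\<phi> r - g r)" if rs: "0 \<le> r" "r \<le> s" "s \<le> t\<^sub>1" for r s
    proof (rule right_derivative_nonpos_imp_le[OF rs(2), of "\<lambda>t. P (\<phi> t - g t)"])
      have "continuous_on {0..t\<^sub>1} (\<lambda>t. \<phi> t - g t)" by (rule cont) (use caus(2) in auto)
      then have "continuous_on {r..s} (\<lambda>t. \<phi> t - g t)"
        by (rule continuous_on_subset) (use rs in auto)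
      then show "continuous_on {r..s} (\<lambda>t. P (\<phi> t - g t))"
        by (rule bounded_linear.continuous_on[OF lin])
      fix t assume "r \<le> t" "t < s"
      then have "0 \<le> t" "t < t\<^sub>1" using rs by simp_all
      from deriv[OF this] obtain u \<rho> u' where u: "0 < \<rho>" "energy F t u = 1" "energy F t u' \<le> 1"
          "((\<lambda>t. P (\<phi> t - g t)) has_vector_derivative \<rho> * (momentum F t u u' - 2)) (at_right t)"
        by blast
      have "\<rho> * (momentum F t u u' - 2) \<le> 0"
        using momentum_le[OF u(2,3)] u(1) by (simp add: mult_le_0_iff)
      with u(4) show "\<exists>D\<le>0. ((\<lambda>t. P (\<phi> t - g t)) has_vector_derivative D) (at_right t)"
        by blast
    qed
    show "P (\<phi> t\<^sub>1 - g t\<^sub>1) \<le> P (\<phi> t - g t)" by (rule *) (use t in simp_all)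
    show "P (\<phi> t - g t) \<le> P (\<phi> 0 - g 0)" by (rule *) (use t in simp_all)
  qed
  have diff: "P (x - y) = P x - P y" for x y
    by (rule linear_diff[OF bounded_linear.linear[OF lin]])
  have init': "P (\<phi> 0 - g 0) \<le> 0" using init by (simp add: diff) (simp add: P_def)
  show "t\<^sub>0 \<le> t\<^sub>1"
  proof (rule ccontr)
    assume "\<not> t\<^sub>0 \<le> t\<^sub>1"
    then have "t\<^sub>1 < t\<^sub>0" by simp
    \<comment> \<open>From \<open>t\<^sub>1\<close> to \<open>t\<^sub>0\<close> the trajectory still
      gains in \<open>P\<close>, so the common end point has a larger value than
      \<open>g t\<^sub>1\<close>, whereas \<open>\<phi> t\<^sub>1\<close> has not.\<close>
    have "- P (g t\<^sub>0) < - P (g t\<^sub>1)"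
    proof (rule right_derivative_neg_imp_less[OF \<open>t\<^sub>1 < t\<^sub>0\<close>, of "\<lambda>t. - P (g t)"])
      show "continuous_on {t\<^sub>1..t\<^sub>0} (\<lambda>t. - P (g t))"
        by (intro continuous_on_minus bounded_linear.continuous_on[OF lin] cont_g)
          (use caus(2) \<open>t\<^sub>1 < t\<^sub>0\<close> in simp_all)
      fix t assume "t\<^sub>1 \<le> t" "t < t\<^sub>0"
      then have "0 \<le> t" using caus(2) by simp
      from traj[OF this] obtain u \<rho> where u: "0 < \<rho>" "(g has_vector_derivative u) (at_right t)"
          "energy F t u = 1" "\<And>w. P w = \<rho> * momentum F t u w" by blast
      have "u \<noteq> 0" using u(3) energy_zero by force
      then have "P u = \<rho> * 2" using u(3,4) momentum_self by simp
      moreover have "((\<lambda>t. - P (g t)) has_vector_derivative - P u) (at_right t)"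
        by (rule has_vector_derivative_minus[OF bounded_linear.has_vector_derivative[OF lin u(2)]])
      ultimately show "\<exists>D<0. ((\<lambda>t. - P (g t)) has_vector_derivative D) (at_right t)"
        using u(1) by (intro exI[of _ "- P u"]) simp
    qed
    moreover have "P (\<phi> t\<^sub>1 - g t\<^sub>1) \<le> 0"
      using decr(2)[of t\<^sub>1] init' caus(2) by simp
    ultimately show False using caus(3) by (simp add: diff)
  qed
  assume "t\<^sub>1 = t\<^sub>0" and t: "t \<in> {0..t\<^sub>0}"
  then have end_eq: "\<phi> t\<^sub>1 - g t\<^sub>1 = 0" using caus(3) by simp
  \<comment> \<open>The gap never increases, starts at most at 0 and ends at 0.\<close>
  have P0: "P (\<phi> s - g s) = 0" if s: "s \<in> {0..t\<^sub>1}" for s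
  proof -
    have "P (\<phi> t\<^sub>1 - g t\<^sub>1) = 0"
      unfolding end_eq by (rule linear_0[OF bounded_linear.linear[OF lin]])
    then show ?thesis using decr[of s] s init' by simp
  qed
  show "\<phi> t = g t"
  proof (cases "t = t\<^sub>1")
    case True
    then show ?thesis using end_eq by simp
  next
    case False
    with t \<open>t\<^sub>1 = t\<^sub>0\<close> have t': "0 \<le> t" "t < t\<^sub>1" by auto
    \<comment> \<open>Integration runs back from the common end point; equality of the starting
      points comes out as a consequence.\<close>
    have "\<phi> t - g t = \<phi> t\<^sub>1 - g t\<^sub>1"
    proof (rule right_derivative_zero_imp_eq[where g = "\<lambda>t. \<phi> t - g t"])
      fix s assume s: "t \<le> s" "s < t\<^sub>1"
      then have "0 \<le> s" using t' by simp
      from deriv[OF this s(2)] obtain u \<rho> u' where u: "0 < \<rho>" "(g has_vector_derivative u) (at_right s)"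
          "energy F s u = 1" "(\<phi> has_vector_derivative u') (at_right s)" "energy F s u' \<le> 1"
          "((\<lambda>t. P (\<phi> t - g t)) has_vector_derivative \<rho> * (momentum F s u u' - 2)) (at_right s)"
        by blast
      have "((\<lambda>t. P (\<phi> t - g t)) has_vector_derivative 0) (at s within {s..t\<^sub>1})"
      proof (rule has_vector_derivative_transform[of s "{s..t\<^sub>1}" _ "\<lambda>_. 0"])
        show "((\<lambda>_. 0) has_vector_derivative 0) (at s within {s..t\<^sub>1})"
          by (rule has_vector_derivative_const)
      qed (use s \<open>0 \<le> s\<close> P0 in auto)
      then have "((\<lambda>t. P (\<phi> t - g t)) has_vector_derivative 0) (at_right s)"
        by (simp add: at_within_Icc_at_right[OF s(2)])
      then have "\<rho> * (momentum F s u u' - 2) = 0"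
        by (rule has_vector_derivative_right_unique[OF u(6)])
      then have "momentum F s u u' = 2" using u(1) by simp
      \<comment> \<open>The equality case of the fundamental inequality.\<close>
      then have "u' = u" using momentum_less[OF u(3,5)] by auto
      then show "((\<lambda>t. \<phi> t - g t) has_vector_derivative 0) (at_right s)"
        using has_vector_derivative_diff[OF u(4,2)] by simp
    qed (use t' cont[OF t'] in simp_all)
    then show ?thesis using end_eq by simp
  qed
qed

text \<open>What remains is the initial inequality for the momentum. For a single point it is an
  equality; for a hypersurface the momentum at \<open>v\<close> is the functional of the supporting
  hyperplane, with orthogonality giving its zeros on tangent vectors and Euler's identity its sign
  on \<open>v\<close>.\<close>

lemma wavemap_strictly_time_minimizing:
  assumes A: "is_singleton A \<or> (compact_hypersurface A \<and> convex_hypersurface A)"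
    and f: "wavemap F A f" and z: "z \<in> wave_params F A"
  shows "strictly_time_minimizing F A f z \<tau>"
proof -
  define v where "v = vector_derivative (\<lambda>t. f t z) (at 0 within {0..})"
  have light: "lightlike_on F {0..} (\<lambda>t. (t, f t z))"
    and pre: "pregeodesic_on (lorentz_finsler F) {0..} (\<lambda>t. (t, f t z))"
    and start: "if is_singleton A then f 0 z = the_elem A \<and> v = z
      else f 0 z = z \<and> finsler_orthogonal F 0 z v A \<and> points_outward A z v"
    using f z unfolding wavemap_def v_def Let_def by blast+
  obtain u where u: "((\<lambda>t. f t z) has_vector_derivative u) (at_right 0)"
    using causal_on_right_derivative[OF lightlike_on_imp_causal_on[OF light], of 0 1] by auto
  \<comment> \<open>\<open>vector_derivative\<close> is defined by choice, so it has to be tied to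
    an existing right derivative.\<close>
  have "vector_derivative (\<lambda>t. f t z) (at_right 0) = u"
    by (rule vector_derivative_within[OF _ u]) simp
  then have v: "((\<lambda>t. f t z) has_vector_derivative v) (at_right 0)"
    using u by (simp add: v_def at_within_atLeast_eq)
  have le: "momentum F 0 v a \<le> momentum F 0 v (f 0 z)" if "a \<in> A" for a
  proof (cases "is_singleton A")
    case True
    then have "a = f 0 z" using start that by (auto elim: is_singletonE)
    then show ?thesis by simp
  next
    case False
    then have z': "f 0 z = z" "finsler_orthogonal F 0 z v A" "points_outward A z v" and "z \<in> A"
      and A': "compact_hypersurface A" "convex_hypersurface A"
      using start z A by (simp_all add: wave_params_def)
    have "v \<noteq> 0" using z'(2) by (simp add: finsler_orthogonal_def)
    have "momentum F 0 v a \<le> momentum F 0 v z"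
    proof (rule convex_hypersurface_supporting[OF _ A'(2) z'(3) momentum_linear[OF \<open>v \<noteq> 0\<close>]])
      show "embedded_submanifold (DIM('a) - 1) A"
        using A'(1) by (simp add: compact_hypersurface_def)
      show "momentum F 0 v u = 0" if "u \<in> tangent_space A z" for u
        using z'(2) that fundamental_tensor_momentum[OF \<open>v \<noteq> 0\<close>, of 0 z u]
        by (simp add: finsler_orthogonal_def)
      show "0 < momentum F 0 v v"
        using momentum_self[OF \<open>v \<noteq> 0\<close>] energy_pos[OF \<open>v \<noteq> 0\<close>] by simp
    qed fact+
    then show ?thesis by (simp add: z'(1))
  qed
  show ?thesis
    unfolding strictly_time_minimizing_def
  proof (intro ballI allI impI, elim conjE)
    fix t\<^sub>0 t\<^sub>1 \<phi>
    assume t0: "t\<^sub>0 \<in> {0<..\<tau>}" and "causal_arrival F A (f t\<^sub>0 z) t\<^sub>1 \<phi>"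
      and ne: "\<not> (t\<^sub>1 = t\<^sub>0 \<and> (\<forall>t\<in>{0..t\<^sub>0}. \<phi> t = f t z))"
    then have arr: "causal_on F {0..t\<^sub>1} (\<lambda>t. (t, \<phi> t))" "0 < t\<^sub>1" "\<phi> t\<^sub>1 = f t\<^sub>0 z" "\<phi> 0 \<in> A"
      by (simp_all add: causal_arrival_def)
    have "0 < t\<^sub>0" using t0 by simp
    note min = lightlike_pregeodesic_minimizing[OF light pre v arr(1-3) le[OF arr(4)] \<open>0 < t\<^sub>0\<close>]
    show "t\<^sub>0 < t\<^sub>1" using min ne by (metis less_eq_real_def)
  qed
qed

end

section \<open>Absence of cut points\<close>

lemma strictly_time_minimizing_imp_time_minimizing:
  "strictly_time_minimizing F A f z \<tau> \<Longrightarrow> time_minimizing F A f z \<tau>"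
  \<comment> \<open>The curve exempted from the strict inequality is the trajectory itself, which
    arrives exactly at \<open>t\<^sub>0\<close>.\<close>
  unfolding strictly_time_minimizing_def time_minimizing_def
  by (metis less_eq_real_def order_refl)

lemma no_cut_point:
  assumes "\<And>\<tau>. time_minimizing F A f z \<tau>" "z \<in> wave_params F A"
  shows "\<not> has_cut_point F A f z"
proof -
  have in_front: "f t z \<in> wavefront F A f t" if "0 < t" for t
    unfolding wavefront_def using assms that by auto
  have "cut_function F A f z = \<infinity>"
  proof (rule ereal_top)
    fix B
    \<comment> \<open>The supremum ranges over positive times, so \<open>B\<close> is first raised
      to a positive number.\<close>
    have "ereal B \<le> ereal (max B 1)" by simp
    also have "\<dots> \<le> cut_function F A f z"
      unfolding cut_function_def by (intro Sup_upper CollectI exI[of _ "max B 1"] conjI refl in_front) simp_all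
    finally show "ereal B \<le> cut_function F A f z" .
  qed
  then show ?thesis by (simp add: has_cut_point_def)
qed

theorem theorem3p2:
  fixes F :: "real \<Rightarrow> real ^ 'n \<Rightarrow> real ^ 'n \<Rightarrow> real"
    and A :: "(real ^ 'n) set"
    and f :: "real \<Rightarrow> real ^ 'n \<Rightarrow> real ^ 'n"
  assumes "CARD('n) \<ge> 2"
    and "time_dep_finsler F"
    and "time_only_dependent F"
    and "finsler_bounds F"
    and "is_singleton A \<or> (compact_hypersurface A \<and> convex_hypersurface A)"
    and "wavemap F A f"
  shows "\<forall>z\<in>wave_params F A.
           \<not> has_cut_point F A f z \<and> (\<forall>\<tau>>0. strictly_time_minimizing F A f z \<tau>)"
proof
  fix z assume z: "z \<in> wave_params F A"
  interpret time_only_finsler F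
    using assms(2,3) by unfold_locales
  have min: "strictly_time_minimizing F A f z \<tau>" for \<tau>
    by (rule wavemap_strictly_time_minimizing[OF assms(5,6) z])
  have "\<not> has_cut_point F A f z"
    by (rule no_cut_point[OF strictly_time_minimizing_imp_time_minimizing[OF min] z])
  with min show "\<not> has_cut_point F A f z \<and> (\<forall>\<tau>>0. strictly_time_minimizing F A f z \<tau>)"
    by blast
qed

end
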